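(* Let $\mathcal{X}$ be finite, $P^\pi\in\mathbb{R}^{\mathcal{X}\times\mathcal{X}}$ row-stochastic, $R^\pi\in\mathbb{R}^{\mathcal{X}}$, $\gamma\in[0,1)$, $K\in\mathbb{N}$, and fix $\Phi_0\in\mathbb{R}^{\mathcal{X}\times K}$. For $M\in\mathbb{N}$, let $\mathbf{w}^1,\dots,\mathbf{w}^M\in\mathbb{R}^K$ have i.i.d. $\mathcal{N}(0,\sigma_M^2)$ entries, held fixed throughout training, and let $(\Phi^M_t)_{t\ge0}$ with $\Phi^M_0=\Phi_0$ solve $$\partial_t\Phi^M_t=\alpha\sum_{m=1}^M\big(R^\pi+\gamma P^\pi\Phi^M_t\mathbf{w}^m-\Phi^M_t\mathbf{w}^m\big)(\mathbf{w}^m)^\top.$$ Consider two settings: (i) learning rate $\alpha=\frac1M$ and $\sigma_M^2=1$ for all $M$; (ii) $\sigma_M^2=\frac1M$ and $\alpha=1$. Then, as $M\to\infty$, the dynamics satisfy respectively $$\text{(i)}\ \lim_{M\to\infty}\partial_t\Phi^M_t\overset{P}{=}-(I-\gamma P^\pi)\Phi^M_t,\qquad \text{(ii)}\ \lim_{M\to\infty}\partial_t\Phi^M_t\overset{D}{=}-(I-\gamma P^\pi)\Phi^M_t+R^\pi\epsilon^\top,\ \epsilon\sim\mathcal{N}(0,I),$$ and the corresponding limiting trajectories are respectively $$\text{(i)}\ \lim_{M\to\infty}\Phi^M_t\overset{P}{=}\exp(-t(I-\gamma P^\pi))\Phi_0,$$ $$\text{(ii)}\ \lim_{M\to\infty}\Phi^M_t\overset{D}{=}\exp(-t(I-\gamma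 P^\pi))\big(\Phi_0-(I-\gamma P^\pi)^{-1}R^\pi\epsilon^\top\big)+(I-\gamma P^\pi)^{-1}R^\pi\epsilon^\top,\ \epsilon\sim\mathcal{N}(0,I).$$
   Context: $\Phi^M_t$ models a feature matrix (representation) shared by $M$ linear value-prediction heads $\mathbf{w}^m$, trained by continuous-time temporal-difference (semi-gradient) dynamics with the heads' weights fixed. $\overset{P}{=}$ denotes equality of the limit in probability and $\overset{D}{=}$ equality in distribution; $\exp$ is the matrix exponential. *)

theory Defs
  imports "HOL-Analysis.Analysis" "HOL-Probability.Probability"
begin

(* Matrices: real^'c^'r is an 'r x 'c matrix (rows indexed by 'r). *)

primrec mat_pow :: "real^'n^'n \<Rightarrow> nat \<Rightarrow> real^'n^'n" where
  "mat_pow A 0 = mat 1"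
| "mat_pow A (Suc n) = A ** mat_pow A n"

definition mat_exp :: "real^'n^'n \<Rightarrow> real^'n^'n" where
  "mat_exp A = (\<Sum>n. (1 / fact n) *\<^sub>R mat_pow A n)"

definition outer :: "real^'r \<Rightarrow> ('c \<Rightarrow> real) \<Rightarrow> real^'c^'r" where
  "outer u v = (\<chi> i j. u $ i * v j)"

definition row_stochastic :: "real^'n^'n \<Rightarrow> bool" where
  "row_stochastic P \<longleftrightarrow> (\<forall>i j. 0 \<le> P $ i $ j) \<and> (\<forall>i. (\<Sum>j\<in>UNIV. P $ i $ j) = 1)"

definition td_field ::
  "real^'x^'x \<Rightarrow> real^'x \<Rightarrow> real \<Rightarrow> real \<Rightarrow> nat \<Rightarrow> (nat \<Rightarrow> real^'k) \<Rightarrow> real^'k^'x \<Rightarrow> real^'k^'x" where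
  "td_field P R \<gamma> \<alpha> M w X =
     \<alpha> *\<^sub>R (\<Sum>m<M. outer (R + \<gamma> *\<^sub>R (P *v (X *v w m)) - X *v w m) (\<lambda>k. w m $ k))"

definition td_model ::
  "'w measure \<Rightarrow> real^'x^'x \<Rightarrow> real^'x \<Rightarrow> real \<Rightarrow> real^'k^'x \<Rightarrow> (nat \<Rightarrow> real) \<Rightarrow> (nat \<Rightarrow> real)
   \<Rightarrow> (nat \<Rightarrow> nat \<Rightarrow> 'w \<Rightarrow> real^'k) \<Rightarrow> (nat \<Rightarrow> real \<Rightarrow> 'w \<Rightarrow> real^'k^'x) \<Rightarrow> bool" where
  "td_model \<Omega> P R \<gamma> \<Phi>0 \<alpha> sd w \<Phi> \<longleftrightarrow>
     (\<forall>M. prob_space.indep_vars \<Omega> (\<lambda>_. borel) (\<lambda>(m, k) \<omega>. w M m \<omega> $ k) ({..<M} \<times> UNIV)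
        \<and> (\<forall>m<M. \<forall>k. distributed \<Omega> lborel (\<lambda>\<omega>. w M m \<omega> $ k) (normal_density 0 (sd M)))) \<and>
     (\<forall>M. \<forall>\<omega>\<in>space \<Omega>. \<Phi> M 0 \<omega> = \<Phi>0 \<and>
        (\<forall>t\<ge>0. ((\<lambda>s. \<Phi> M s \<omega>) has_vector_derivative
                   td_field P R \<gamma> (\<alpha> M) M (\<lambda>m. w M m \<omega>) (\<Phi> M t \<omega>)) (at t within {0..})))"

definition conv_in_prob :: "'w measure \<Rightarrow> (nat \<Rightarrow> 'w \<Rightarrow> 'b::metric_space) \<Rightarrow> 'b \<Rightarrow> bool" where
  "conv_in_prob \<Omega> X c \<longleftrightarrow>
     (\<forall>e>0. (\<lambda>n. measure \<Omega> {\<omega>\<in>space \<Omega>. dist (X n \<omega>) c > e}) \<longlonglongrightarrow> 0)"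

definition conv_in_dist ::
  "'w measure \<Rightarrow> (nat \<Rightarrow> 'w \<Rightarrow> 'b::metric_space) \<Rightarrow> 'e measure \<Rightarrow> ('e \<Rightarrow> 'b) \<Rightarrow> bool" where
  "conv_in_dist \<Omega> X \<mu> g \<longleftrightarrow>
     (\<forall>f :: 'b \<Rightarrow> real. continuous_on UNIV f \<and> bounded (range f) \<longrightarrow>
        (\<lambda>n. \<integral>\<omega>. f (X n \<omega>) \<partial>\<Omega>) \<longlonglongrightarrow> (\<integral>e. f (g e) \<partial>\<mu>))"

definition std_gauss :: "('k::finite \<Rightarrow> real) measure" where
  "std_gauss = PiM UNIV (\<lambda>_. density lborel std_normal_density)"

end

theory Submission
  imports Defs
begin

text \<open>
  The vector field depends on the heads only through \<open>b = \<alpha> \<Sum>\<^sub>m w\<^sub>m\<close> and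
  \<open>G = \<alpha> \<Sum>\<^sub>m w\<^sub>m w\<^sub>m\<^sup>T\<close>: it is \<open>X \<mapsto> R b\<^sup>T - (I - \<gamma> P) X G\<close>. The trajectory is therefore
  the Taylor series of an affine flow, which is jointly continuous in \<open>(b, G)\<close>; this also supplies
  the measurability of \<open>\<Phi>\<^sub>t\<close>. In both regimes a second-moment bound gives \<open>G \<rightarrow> I\<close> in probability.
  In regime (i) also \<open>b \<rightarrow> 0\<close> in probability, while in regime (ii) \<open>b\<close> is exactly standard
  normal for every \<open>M \<ge> 1\<close>. Continuous mapping and a Slutsky argument conclude, since at \<open>G = I\<close>
  the series sums to the stated closed form.
\<close>

subsection \<open>Affine flows\<close>

text \<open>\<open>G\<close> acts on \<open>X\<close> from the right and
  \<open>A = I - \<gamma> P\<close> from the left, so for finite \<open>M\<close> the flow is not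
  left multiplication by a matrix exponential, and \<open>G\<close> may be singular. The power
  series of the operator \<open>X \<mapsto> - A X G\<close> needs neither diagonalisation nor
  inversion of \<open>G\<close>; at \<open>G = I\<close> this operator is left multiplication by
  \<open>- A\<close> and the matrix exponential reappears. The model relates heads only within one
  value of \<open>M\<close>; families for different \<open>M\<close> have no prescribed joint law.
  The limits therefore rest on moment bounds of order \<open>1 / M\<close>, proved separately for
  each \<open>M\<close>. The claimed limit of the derivative still contains the moving trajectory,
  so it is read as convergence of the residual \<open>td_field + A \<Phi>\<close>. The residual is
  again continuous in \<open>(b, G)\<close>, and at \<open>G = I\<close> its two terms in
  \<open>A\<close> cancel whatever the trajectory is. At \<open>M = 0\<close> division by zero
  yields 0, hence the restriction to positive indices in the limit lemmas.\<close>

primrec affine_coeff :: "('a \<Rightarrow> 'a) \<Rightarrow> 'a \<Rightarrow> 'a \<Rightarrow> nat \<Rightarrow> 'a::real_normed_vector" where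
  "affine_coeff L r x 0 = x"
| "affine_coeff L r x (Suc n) = L (affine_coeff L r x n) + (if n = 0 then r else 0)"

text \<open>For linear \<open>L\<close>, the coefficients are the derivatives at 0 of the solution
  of \<open>X' = L X + r\<close> with \<open>X 0 = x\<close>. The constant \<open>r\<close> enters
  the first derivative directly and is differentiated away afterwards, which is why the recursion
  adds it only at \<open>n = 0\<close>.\<close>

definition affine_flow :: "('a \<Rightarrow> 'a) \<Rightarrow> 'a \<Rightarrow> 'a \<Rightarrow> real \<Rightarrow> 'a::real_normed_vector" where
  "affine_flow L r x t = (\<Sum>n. (t ^ n / fact n) *\<^sub>R affine_coeff L r x n)"

text \<open>The base is \<open>\<kappa> + 1\<close> because the inhomogeneity has to be absorbed:
  for \<open>\<kappa> = 0\<close> the first coefficient is still \<open>r\<close>. Since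
  \<open>(\<kappa> + 1) ^ n\<close> is at least 1, the extra summand dominates
  \<open>norm r\<close>.\<close>

lemma norm_affine_coeff_le:
  assumes L: "\<And>y. norm (L y) \<le> \<kappa> * norm y" and "0 \<le> \<kappa>"
  shows "norm (affine_coeff L r x n) \<le> (\<kappa> + 1) ^ n * (norm x + norm r)"
proof (induction n)
  case (Suc n)
  let ?C = "norm x + norm r"
  have "norm (affine_coeff L r x (Suc n)) \<le> \<kappa> * norm (affine_coeff L r x n) + (if n = 0 then norm r else 0)"
    using norm_triangle_le[OF add_mono[OF L order_refl]] by (auto simp: L)
  also have "\<dots> \<le> \<kappa> * ((\<kappa> + 1) ^ n * ?C) + (\<kappa> + 1) ^ n * ?C"
    using Suc \<open>0 \<le> \<kappa>\<close> by (intro add_mono mult_left_mono) auto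
  also have "\<dots> = (\<kappa> + 1) ^ Suc n * ?C" by (simp add: algebra_simps)
  finally show ?case .
qed simp

text \<open>The majorant is a term of an exponential series and depends on \<open>x\<close> and
  \<open>r\<close> only through \<open>C\<close>, so it can serve a whole neighbourhood of
  parameters at once.\<close>

lemma norm_affine_term_le:
  assumes L: "\<And>y. norm (L y) \<le> \<kappa> * norm y" and "0 \<le> \<kappa>" and C: "norm x + norm r \<le> C"
  shows "norm ((t ^ n / fact n) *\<^sub>R affine_coeff L r x n) \<le> C * ((\<bar>t\<bar> * (\<kappa> + 1)) ^ n /\<^sub>R fact n)"
proof -
  have "norm (affine_coeff L r x n) \<le> (\<kappa> + 1) ^ n * C"
    using norm_affine_coeff_le[of L \<kappa> r x n] assms
    by (meson mult_left_mono order_trans zero_le_power add_nonneg_nonneg zero_le_one)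
  then have "norm ((t ^ n / fact n) *\<^sub>R affine_coeff L r x n) \<le> \<bar>t\<bar> ^ n / fact n * ((\<kappa> + 1) ^ n * C)"
    by (simp add: power_abs divide_right_mono mult_left_mono)
  also have "\<dots> = C * ((\<bar>t\<bar> * (\<kappa> + 1)) ^ n /\<^sub>R fact n)"
    unfolding power_mult_distrib by (simp add: field_simps)
  finally show ?thesis .
qed

text \<open>The Taylor partial sums are the Picard iterates started at the constant
  \<open>X 0\<close>. Any given solution is compared with them directly: each iteration integrates
  the previous error, so the error on \<open>[0, t]\<close> is at most a constant times a term of
  the series for \<open>exp (\<kappa> t)\<close>. This proves uniqueness and the series formula
  together.\<close>

lemma affine_flow_solves:
  fixes X :: "real \<Rightarrow> 'a::banach"
  assumes L: "bounded_linear L"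
    and X: "\<And>t. t \<ge> 0 \<Longrightarrow> (X has_vector_derivative L (X t) + r) (at t within {0..})"
    and "t \<ge> 0"
  shows "X t = affine_flow L r (X 0) t"
proof -
  define T where "T N s = (\<Sum>n<N. (s ^ n / fact n) *\<^sub>R affine_coeff L r (X 0) n)" for N s
  obtain \<kappa> where \<kappa>: "\<kappa> > 0" "\<And>y. norm (L y) \<le> norm y * \<kappa>"
    using bounded_linear.pos_bounded[OF L] by blast
  have contX: "continuous_on {0..t} X"
    unfolding continuous_on_eq_continuous_within
  proof
    fix s assume "s \<in> {0..t}"
    then have "continuous (at s within {0..}) X"
      using X[of s] by (auto intro: has_vector_derivative_continuous)
    then show "continuous (at s within {0..t}) X"
      by (rule continuous_within_subset) auto
  qed
  have Xat: "(X has_vector_derivative L (X s) + r) (at s)" if "0 < s" for s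
    using X[of s] that at_within_interior[of s "{0..}"] by (auto simp: interior_Ici)
  have T0: "T (Suc N) 0 = X 0" for N
    unfolding T_def by (subst sum.lessThan_Suc_shift) simp
  \<comment> \<open>Differentiating lowers the degree by one, which gives the Picard relation. The
    shift to \<open>Suc N\<close> keeps the sum nonempty, so that \<open>r\<close> occurs in it
    exactly once.\<close>
  have T': "((\<lambda>s. T (Suc (Suc N)) s) has_vector_derivative L (T (Suc N) s) + r) (at s)" for N s
  proof -
    have 1: "((\<lambda>s. s ^ Suc n / fact (Suc n)) has_real_derivative s ^ n / fact n) (at s)" for n
      by (rule derivative_eq_intros refl | simp)+
    have "((\<lambda>s. X 0 + (\<Sum>n<Suc N. (s ^ Suc n / fact (Suc n)) *\<^sub>R affine_coeff L r (X 0) (Suc n)))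
        has_vector_derivative 0 + (\<Sum>n<Suc N. (s ^ n / fact n) *\<^sub>R affine_coeff L r (X 0) (Suc n))) (at s)"
      by (intro has_vector_derivative_add has_vector_derivative_const has_vector_derivative_sum
           has_vector_derivative_scaleR[where g="\<lambda>_. c" and g'=0 for c, simplified] 1)
    also have "(\<Sum>n<Suc N. (s ^ n / fact n) *\<^sub>R affine_coeff L r (X 0) (Suc n))
       = L (T (Suc N) s) + (\<Sum>n<Suc N. if n = 0 then r else 0)"
      unfolding T_def linear_sum[OF bounded_linear.linear[OF L]]
      by (subst sum.distrib[symmetric], rule sum.cong)
         (auto simp: scaleR_add_right linear_scale[OF bounded_linear.linear[OF L]])
    also have "(\<Sum>n<Suc N. if n = 0 then r else 0) = r" by simp
    also have "(\<lambda>s. X 0 + (\<Sum>n<Suc N. (s ^ Suc n / fact (Suc n)) *\<^sub>R affine_coeff L r (X 0) (Suc n)))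
       = T (Suc (Suc N))"
      unfolding T_def by (rule ext, subst sum.lessThan_Suc_shift[of _ "Suc N"]) simp
    finally show ?thesis by simp
  qed
  have contT: "continuous_on S (T N)" for N S
    unfolding T_def by (intro continuous_intros) auto
  \<comment> \<open>\<open>T 1\<close> is the constant \<open>X 0\<close>; boundedness of this first
    error on the compact interval starts the induction.\<close>
  have "compact ((\<lambda>s. X s - T 1 s) ` {0..t})"
    by (intro compact_continuous_image continuous_intros contX contT) auto
  then obtain B where B: "\<And>s. s \<in> {0..t} \<Longrightarrow> norm (X s - T 1 s) \<le> B"
    by (meson compact_imp_bounded bounded_iff imageI)
  have err: "norm (X s - T (Suc N) s) \<le> B * \<kappa> ^ N * s ^ N / fact N" if "0 \<le> s" "s \<le> t" for N s
    using that
  proof (induction N arbitrary: s)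
    case 0
    then show ?case using B[of s] by simp
  next
    case (Suc N)
    show ?case
    proof (cases "s = 0")
      case True
      then show ?thesis by (simp add: T0)
    next
      case False
      let ?E = "\<lambda>u. X u - T (Suc (Suc N)) u" and ?\<phi> = "\<lambda>u. B * \<kappa> ^ Suc N * u ^ Suc N / fact (Suc N)"
      \<comment> \<open>The mean value inequality replaces integration: the derivative of
        \<open>?E\<close> is \<open>L\<close> applied to the previous error, and
        \<open>?\<phi>\<close> is the antiderivative of the resulting bound. Both vanish at
        0.\<close>
      have "norm (?E s - ?E 0) \<le> ?\<phi> s - ?\<phi> 0"
      proof (rule differentiable_bound_general[where f="?E" and \<phi>="?\<phi>" and a=0 and b=s])
        show "continuous_on {0..s} ?E"
          using Suc.prems by (intro continuous_intros contT continuous_on_subset[OF contX]) auto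
        fix u assume u: "0 < u" "u < s"
        show "(?E has_vector_derivative (L (X u) + r) - (L (T (Suc N) u) + r)) (at u)"
          by (intro has_vector_derivative_diff Xat T' u)
        show "(?\<phi> has_vector_derivative B * \<kappa> ^ Suc N * u ^ N / fact N) (at u)"
          unfolding has_real_derivative_iff_has_vector_derivative[symmetric]
          by (rule derivative_eq_intros refl | simp)+
        have "norm ((L (X u) + r) - (L (T (Suc N) u) + r)) = norm (L (X u - T (Suc N) u))"
          by (simp add: linear_diff[OF bounded_linear.linear[OF L]])
        also have "\<dots> \<le> norm (X u - T (Suc N) u) * \<kappa>" by (rule \<kappa>)
        also have "\<dots> \<le> (B * \<kappa> ^ N * u ^ N / fact N) * \<kappa>"
          using Suc u \<kappa> by (intro mult_right_mono Suc.IH) auto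
        finally show "norm ((L (X u) + r) - (L (T (Suc N) u) + r)) \<le> B * \<kappa> ^ Suc N * u ^ N / fact N"
          by (simp add: algebra_simps)
      qed (use False Suc.prems in \<open>auto intro!: continuous_intros\<close>)
      then show ?thesis by (simp add: T0)
    qed
  qed
  have "(\<lambda>N. B * ((\<kappa> * t) ^ N /\<^sub>R fact N)) \<longlonglongrightarrow> B * 0"
    by (intro tendsto_mult tendsto_const summable_LIMSEQ_zero summable_exp_generic)
  then have lim0: "(\<lambda>N. B * \<kappa> ^ N * t ^ N / fact N) \<longlonglongrightarrow> 0"
    by (simp add: power_mult_distrib field_simps)
  have "(\<lambda>N. X t - T (Suc N) t) \<longlonglongrightarrow> 0"
    by (rule Lim_null_comparison[OF _ lim0]) (use err[of t] \<open>t \<ge> 0\<close> in auto)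
  then have "(\<lambda>N. T (Suc N) t) \<longlonglongrightarrow> X t"
    using LIM_zero_cancel[of "\<lambda>N. - T (Suc N) t" "- X t" sequentially]
    by (simp add: tendsto_minus_cancel_left[symmetric] add.commute)
  then have "(\<lambda>N. T N t) \<longlonglongrightarrow> X t"
    by (rule LIMSEQ_imp_Suc)
  then have "(\<lambda>n. (t ^ n / fact n) *\<^sub>R affine_coeff L r (X 0) n) sums X t"
    by (simp add: sums_def T_def)
  then show ?thesis
    by (simp add: affine_flow_def sums_iff)
qed

text \<open>Each coefficient is continuous in the parameter by induction. The operator bound
  \<open>\<kappa>\<close> may be unbounded over the whole parameter space, so uniform convergence is
  obtained only near a given point, which is enough for continuity there.\<close>

lemma continuous_affine_flow:
  fixes L :: "'p::metric_space \<Rightarrow> 'a \<Rightarrow> 'a::banach"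
  assumes L: "continuous_on UNIV (\<lambda>(p, y). L p y)"
    and \<kappa>: "\<And>p y. norm (L p y) \<le> \<kappa> p * norm y" "\<And>p. 0 \<le> \<kappa> p" "continuous_on UNIV \<kappa>"
    and r: "continuous_on UNIV r"
  shows "continuous_on UNIV (\<lambda>p. affine_flow (L p) (r p) x t)"
proof -
  have cc: "continuous_on UNIV (\<lambda>p. affine_coeff (L p) (r p) x n)" for n
  proof (induction n)
    case (Suc n)
    have "continuous_on UNIV (\<lambda>p. case (p, affine_coeff (L p) (r p) x n) of (p, y) \<Rightarrow> L p y)"
      by (rule continuous_on_compose2[OF L]) (intro continuous_intros Suc, auto)
    then show ?case
      by (cases "n = 0") (auto intro!: continuous_intros r)
  qed simp
  have "isCont (\<lambda>p. affine_flow (L p) (r p) x t) p0" for p0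
  proof -
    \<comment> \<open>On this open set \<open>\<kappa>\<close> and \<open>norm r\<close> exceed
      their values at \<open>p0\<close> by less than 1. In the majorant below, one summand 1 in
      \<open>\<kappa> p0 + 1 + 1\<close> comes from \<open>U\<close>, the other from the growth
      bound on the coefficients.\<close>
    define U where "U = {p. \<kappa> p < \<kappa> p0 + 1} \<inter> {p. norm (r p) < norm (r p0) + 1}"
    have "open U" unfolding U_def
      by (intro open_Int open_Collect_less continuous_intros \<kappa> r)
    have "p0 \<in> U" by (simp add: U_def)
    have "uniform_limit U (\<lambda>N p. \<Sum>n<N. (t ^ n / fact n) *\<^sub>R affine_coeff (L p) (r p) x n)
       (\<lambda>p. affine_flow (L p) (r p) x t) sequentially"
      unfolding affine_flow_def
    proof (rule Weierstrass_m_test)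
      show "summable (\<lambda>n. (norm x + norm (r p0) + 1) * ((\<bar>t\<bar> * (\<kappa> p0 + 1 + 1)) ^ n /\<^sub>R fact n))"
        by (intro summable_mult summable_exp_generic)
      fix n p assume p: "p \<in> U"
      have "norm (L p y) \<le> (\<kappa> p0 + 1) * norm y" for y
        by (rule order_trans[OF \<kappa>(1) mult_right_mono]) (use p in \<open>auto simp: U_def\<close>)
      then show "norm ((t ^ n / fact n) *\<^sub>R affine_coeff (L p) (r p) x n)
          \<le> (norm x + norm (r p0) + 1) * ((\<bar>t\<bar> * (\<kappa> p0 + 1 + 1)) ^ n /\<^sub>R fact n)"
        using p \<kappa>(2)[of p0] by (intro norm_affine_term_le) (auto simp: U_def)
    qed
    then have "continuous_on U (\<lambda>p. affine_flow (L p) (r p) x t)"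
      by (rule uniform_limit_theorem[rotated])
         (auto intro!: always_eventually continuous_intros continuous_on_subset[OF cc])
    then show ?thesis
      using \<open>open U\<close> \<open>p0 \<in> U\<close> by (simp add: continuous_on_eq_continuous_at)
  qed
  then show ?thesis
    by (simp add: continuous_on_eq_continuous_at)
qed

section \<open>Matrix algebra, invertibility and the matrix exponential\<close>

lemma bounded_bilinear_matrix_mult:
  "bounded_bilinear ((**) :: real^'n^'m \<Rightarrow> real^'k^'n \<Rightarrow> real^'k^'m)"
  unfolding bilinear_conv_bounded_bilinear[symmetric] bilinear_def
  by (auto intro!: linearI simp: vec_eq_iff matrix_matrix_mult_def algebra_simps sum.distrib sum_distrib_left)

lemma bounded_bilinear_outer:
  "bounded_bilinear (\<lambda>(u::real^'r) (v::real^'c). outer u (($) v))"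
  unfolding bilinear_conv_bounded_bilinear[symmetric] bilinear_def
  by (auto intro!: linearI simp: outer_def vec_eq_iff algebra_simps)

text \<open>A row-stochastic matrix does not increase the maximum norm. A kernel vector satisfies
  \<open>x = \<gamma> P x\<close>, so its maximum norm \<open>m\<close> obeys
  \<open>m \<le> \<gamma> m\<close> and must vanish.\<close>

lemma row_stochastic_invertible:
  assumes P: "row_stochastic P" and \<gamma>: "0 \<le> \<gamma>" "\<gamma> < 1"
  shows "invertible (mat 1 - \<gamma> *\<^sub>R P)"
proof -
  have "x = 0" if x: "(mat 1 - \<gamma> *\<^sub>R P) *v x = 0" for x
  proof -
    have fix_eq: "x = \<gamma> *\<^sub>R (P *v x)"
      using x by (simp add: matrix_vector_mult_diff_rdistrib scaleR_matrix_vector_assoc)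
    define m where "m = Max (range (\<lambda>i. \<bar>x $ i\<bar>))"
    have le: "\<bar>x $ i\<bar> \<le> m" for i unfolding m_def by simp
    have "m \<in> range (\<lambda>i. \<bar>x $ i\<bar>)" unfolding m_def by (rule Max_in) auto
    then obtain i where i: "m = \<bar>x $ i\<bar>" by blast
    have "m = \<gamma> * \<bar>\<Sum>j\<in>UNIV. P $ i $ j * x $ j\<bar>"
      unfolding i using \<gamma> by (subst fix_eq) (simp add: matrix_vector_mult_def abs_mult)
    also have "\<bar>\<Sum>j\<in>UNIV. P $ i $ j * x $ j\<bar> \<le> (\<Sum>j\<in>UNIV. P $ i $ j * m)"
      using P le by (intro order_trans[OF sum_abs] sum_mono)
        (auto simp: row_stochastic_def abs_mult intro: mult_left_mono)
    also have "\<dots> = m"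
      using P by (simp add: sum_distrib_right[symmetric] row_stochastic_def)
    finally have "m \<le> \<gamma> * m" using \<gamma> by (simp add: mult_left_mono)
    moreover have "m \<ge> 0" using i by simp
    ultimately have "m = 0"
      using \<gamma> by (smt (verit, ccfv_SIG) mult_less_cancel_right2)
    then show ?thesis using le by (simp add: vec_eq_iff)
  qed
  then show ?thesis
    unfolding invertible_left_inverse matrix_left_invertible_ker by blast
qed

lemma summable_affine_flow:
  fixes L :: "'a \<Rightarrow> 'a::banach"
  assumes L: "bounded_linear L"
  shows "summable (\<lambda>n. (t ^ n / fact n) *\<^sub>R affine_coeff L r x n)"
proof -
  obtain \<kappa> where \<kappa>: "\<kappa> > 0" "\<And>y. norm (L y) \<le> norm y * \<kappa>"
    using bounded_linear.pos_bounded[OF L] by blast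
  show ?thesis
  proof (rule summable_comparison_test')
    show "summable (\<lambda>n. (norm x + norm r) * ((\<bar>t\<bar> * (\<kappa> + 1)) ^ n /\<^sub>R fact n))"
      by (intro summable_mult summable_exp_generic)
    show "norm ((t ^ n / fact n) *\<^sub>R affine_coeff L r x n)
        \<le> (norm x + norm r) * ((\<bar>t\<bar> * (\<kappa> + 1)) ^ n /\<^sub>R fact n)" for n
      using \<kappa> by (intro norm_affine_term_le) (auto simp: mult.commute)
  qed
qed

lemma outer_matrix_vector_mult: "outer (B *v u) v = B ** outer u v"
  by (auto simp: outer_def vec_eq_iff matrix_matrix_mult_def matrix_vector_mult_def
       sum_distrib_right mult.assoc)

text \<open>\<open>mat_exp\<close> is a bare infinite sum and says nothing until summability is
  known. The powers of \<open>A\<close> are the affine coefficients for \<open>r = 0\<close> and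
  initial value the identity, so the earlier majorant applies at time 1.\<close>

lemma mat_exp_sums: "(\<lambda>n. (1 / fact n) *\<^sub>R mat_pow A n) sums mat_exp A"
proof -
  have eq: "affine_coeff ((**) A) 0 (mat 1) n = mat_pow A n" for n
    by (induction n) auto
  have "summable (\<lambda>n. (1 ^ n / fact n) *\<^sub>R affine_coeff ((**) A) 0 (mat 1) n)"
    by (intro summable_affine_flow bounded_bilinear.bounded_linear_right[OF bounded_bilinear_matrix_mult])
  then show ?thesis
    unfolding mat_exp_def eq by (simp add: summable_sums)
qed

lemma mat_pow_scaleR: "mat_pow (c *\<^sub>R A) n = c ^ n *\<^sub>R mat_pow A n"
  by (induction n)
     (auto simp: bounded_bilinear.scaleR_left[OF bounded_bilinear_matrix_mult]
       bounded_bilinear.scaleR_right[OF bounded_bilinear_matrix_mult])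

text \<open>With inhomogeneity \<open>A ** z\<close> the matrix \<open>z\<close> is an equilibrium,
  and the deviation from it obeys the homogeneous equation. On the level of coefficients,
  \<open>z\<close> survives only in the term of order 0.\<close>

lemma affine_flow_eq_mat_exp:
  fixes A :: "real^'n^'n" and x z :: "real^'k^'n"
  shows "affine_flow (\<lambda>y. - (A ** y)) (A ** z) x t = mat_exp ((- t) *\<^sub>R A) ** (x - z) + z"
proof -
  interpret mm: bounded_bilinear "(**) :: real^'n^'n \<Rightarrow> real^'k^'n \<Rightarrow> real^'k^'n"
    by (rule bounded_bilinear_matrix_mult)
  have coeff: "affine_coeff (\<lambda>y. - (A ** y)) (A ** z) x n
      = (-1) ^ n *\<^sub>R (mat_pow A n ** (x - z)) + (if n = 0 then z else 0)" for n
    by (induction n)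
       (auto simp: mm.add_right mm.diff_right mm.minus_right mm.scaleR_right matrix_mul_assoc)
  have "(\<lambda>n. ((1 / fact n) *\<^sub>R mat_pow ((- t) *\<^sub>R A) n) ** (x - z) + (if n = 0 then z else 0))
      sums (mat_exp ((- t) *\<^sub>R A) ** (x - z) + z)"
    by (intro sums_add mat_exp_sums sums_single[of 0 "\<lambda>_. z", simplified]
          bounded_linear.sums[OF mm.bounded_linear_left])
  also have "(\<lambda>n. ((1 / fact n) *\<^sub>R mat_pow ((- t) *\<^sub>R A) n) ** (x - z) + (if n = 0 then z else 0))
     = (\<lambda>n. (t ^ n / fact n) *\<^sub>R affine_coeff (\<lambda>y. - (A ** y)) (A ** z) x n)"
    unfolding coeff mat_pow_scaleR
    by (auto simp: fun_eq_iff mm.scaleR_left scaleR_add_right power_minus[of t] mult.commute)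
  finally show ?thesis
    by (simp add: affine_flow_def sums_iff)
qed

subsection \<open>The vector field as a function of \<open>(b, G)\<close>\<close>

definition head_stats :: "real \<Rightarrow> nat \<Rightarrow> (nat \<Rightarrow> real^'k) \<Rightarrow> (real^'k) \<times> (real^'k^'k)" where
  "head_stats \<alpha> M w =
     (\<alpha> *\<^sub>R (\<Sum>m<M. w m), \<alpha> *\<^sub>R (\<Sum>m<M. outer (w m) (($) (w m))))"

definition stats_field :: "real^'x^'x \<Rightarrow> real^'x \<Rightarrow> (real^'k) \<times> (real^'k^'k) \<Rightarrow> real^'k^'x \<Rightarrow> real^'k^'x" where
  "stats_field A R p X = - (A ** X ** snd p) + outer R (($) (fst p))"

definition stats_flow :: "real^'x^'x \<Rightarrow> real^'x \<Rightarrow> real^'k^'x \<Rightarrow> real \<Rightarrow> (real^'k) \<times> (real^'k^'k) \<Rightarrow> real^'k^'x" where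
  "stats_flow A R X0 t p = affine_flow (\<lambda>X. - (A ** X ** snd p)) (outer R (($) (fst p))) X0 t"

text \<open>The temporal-difference error of a head \<open>v\<close> is \<open>R - A X v\<close>.
  Its outer product with \<open>v\<close> is \<open>R\<close> times \<open>v\<close> transposed,
  minus \<open>A X\<close> times the outer square of \<open>v\<close>; both pieces are linear in the
  quantities summed over the heads.\<close>

lemma td_field_eq_stats_field:
  "td_field P R \<gamma> \<alpha> M w X = stats_field (mat 1 - \<gamma> *\<^sub>R P) R (head_stats \<alpha> M w) X"
proof -
  let ?A = "mat 1 - \<gamma> *\<^sub>R P"
  interpret om: bounded_bilinear "\<lambda>(u::real^'b) (v::real^'a). outer u (($) v)"
    by (rule bounded_bilinear_outer)
  interpret mm: bounded_bilinear "(**) :: real^'b^'b \<Rightarrow> real^'a^'b \<Rightarrow> real^'a^'b"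
    by (rule bounded_bilinear_matrix_mult)
  interpret mm': bounded_bilinear "(**) :: real^'a^'b \<Rightarrow> real^'a^'a \<Rightarrow> real^'a^'b"
    by (rule bounded_bilinear_matrix_mult)
  have A: "R + \<gamma> *\<^sub>R (P *v (X *v v)) - X *v v = R - (?A ** X) *v v" for v
    by (simp add: matrix_vector_mult_diff_rdistrib scaleR_matrix_vector_assoc
         matrix_vector_mul_assoc[symmetric])
  have "td_field P R \<gamma> \<alpha> M w X = \<alpha> *\<^sub>R (\<Sum>m<M. outer R (($) (w m)) - (?A ** X) ** outer (w m) (($) (w m)))"
    unfolding td_field_def A by (simp add: om.diff_left outer_matrix_vector_mult)
  then show ?thesis
    by (simp add: stats_field_def head_stats_def sum_subtractf om.sum_right om.scaleR_right
         mm'.sum_right mm'.scaleR_right scaleR_diff_right scaleR_right.sum)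
qed

lemma td_solution_eq_stats_flow:
  assumes "\<And>t. t \<ge> 0 \<Longrightarrow>
     (X has_vector_derivative td_field P R \<gamma> \<alpha> M w (X t)) (at t within {0..})"
    and "t \<ge> 0"
  shows "X t = stats_flow (mat 1 - \<gamma> *\<^sub>R P) R (X 0) t (head_stats \<alpha> M w)"
  unfolding stats_flow_def
proof (rule affine_flow_solves)
  show "bounded_linear (\<lambda>X. - ((mat 1 - \<gamma> *\<^sub>R P) ** X ** snd (head_stats \<alpha> M w)))"
    by (intro bounded_linear_minus
          bounded_linear_compose[OF bounded_bilinear.bounded_linear_left[OF bounded_bilinear_matrix_mult]]
          bounded_bilinear.bounded_linear_right[OF bounded_bilinear_matrix_mult])
qed (use assms in \<open>auto simp: td_field_eq_stats_field stats_field_def\<close>)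

lemma continuous_stats_flow: "continuous_on UNIV (stats_flow A R X0 t :: _ \<Rightarrow> real^'k::finite^'x::finite)"
proof -
  interpret om: bounded_bilinear "\<lambda>(u::real^'x) (v::real^'k). outer u (($) v)"
    by (rule bounded_bilinear_outer)
  interpret mm: bounded_bilinear "(**) :: real^'x^'x \<Rightarrow> real^'k^'x \<Rightarrow> real^'k^'x"
    by (rule bounded_bilinear_matrix_mult)
  interpret mm': bounded_bilinear "(**) :: real^'k^'x \<Rightarrow> real^'k^'k \<Rightarrow> real^'k^'x"
    by (rule bounded_bilinear_matrix_mult)
  obtain K where K: "K > 0" "\<And>a b. norm ((a :: real^'x^'x) ** (b :: real^'k^'x)) \<le> norm a * norm b * K"
    using mm.pos_bounded by blast
  obtain K' where K': "K' > 0" "\<And>a b. norm ((a :: real^'k^'x) ** (b :: real^'k^'k)) \<le> norm a * norm b * K'"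
    using mm'.pos_bounded by blast
  \<comment> \<open>\<open>K\<close> and \<open>K'\<close> bound the two matrix products as bilinear
    maps. The resulting operator bound varies continuously with \<open>G\<close>.\<close>
  define \<kappa> where "\<kappa> p = norm A * K * K' * norm (snd p :: real^'k^'k)" for p :: "(real^'k) \<times> (real^'k^'k)"
  show ?thesis
    unfolding stats_flow_def
  proof (rule continuous_affine_flow)
    show "norm (- (A ** X ** snd p)) \<le> \<kappa> p * norm X" for p and X :: "real^'k^'x"
    proof -
      have "norm (A ** X ** snd p) \<le> norm (A ** X) * norm (snd p) * K'" by (rule K')
      also have "\<dots> \<le> (norm A * norm X * K) * norm (snd p) * K'"
        using K K' by (intro mult_right_mono) auto
      finally show ?thesis by (simp add: \<kappa>_def algebra_simps)
    qed
    show "0 \<le> \<kappa> p" for p using K K' by (simp add: \<kappa>_def)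
    show "continuous_on UNIV \<kappa>" unfolding \<kappa>_def by (intro continuous_intros)
    show "continuous_on UNIV (\<lambda>p::(real^'k) \<times> (real^'k^'k). outer R (($) (fst p)))"
      by (intro om.continuous_on continuous_intros)
    show "continuous_on UNIV (\<lambda>(p::(real^'k) \<times> (real^'k^'k), X). - (A ** X ** snd p))"
      unfolding case_prod_beta
      by (intro continuous_intros mm.continuous_on mm'.continuous_on)
  qed
qed

lemma continuous_stats_field:
  fixes A :: "real^'x::finite^'x" and X :: "_ \<Rightarrow> real^'k::finite^'x"
  assumes "continuous_on UNIV X"
  shows "continuous_on UNIV (\<lambda>p. stats_field A R p (X p))"
  unfolding stats_field_def
  by (intro continuous_intros assms bounded_bilinear.continuous_on[OF bounded_bilinear_matrix_mult]
       bounded_bilinear.continuous_on[OF bounded_bilinear_outer])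

text \<open>Here invertibility enters: it supplies the equilibrium \<open>z\<close> with
  \<open>A ** z\<close> equal to the inhomogeneity, as required by
  \<open>affine_flow_eq_mat_exp\<close>.\<close>

lemma stats_flow_mat_1:
  fixes A :: "real^'x^'x" and R :: "real^'x" and b :: "real^'k"
  assumes "invertible A"
  defines "z \<equiv> outer (matrix_inv A *v R) (($) b)"
  shows "stats_flow A R X0 t (b, mat 1) = mat_exp ((- t) *\<^sub>R A) ** (X0 - z) + z"
proof -
  have "A ** matrix_inv A = mat 1"
    using assms(1) unfolding matrix_inv_def invertible_def by (metis (mono_tags, lifting) someI_ex)
  moreover have "A ** z = outer (A *v (matrix_inv A *v R)) (($) b)"
    by (simp add: z_def outer_matrix_vector_mult)
  ultimately have "A ** z = outer R (($) b)"
    by (simp add: matrix_vector_mul_assoc)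
  then show ?thesis
    using affine_flow_eq_mat_exp[of A z X0 t] by (simp add: stats_flow_def)
qed

subsection \<open>Convergence of random variables\<close>

text \<open>Agreement is asked only on \<open>space \<Omega>\<close>, because the differential
  equation is given only for those outcomes.\<close>

lemma conv_in_prob_cong:
  assumes "\<And>n \<omega>. \<omega> \<in> space \<Omega> \<Longrightarrow> X n \<omega> = Y n \<omega>" and "c = d"
  shows "conv_in_prob \<Omega> X c \<longleftrightarrow> conv_in_prob \<Omega> Y d"
  using assms unfolding conv_in_prob_def by (simp cong: conj_cong)

lemma conv_in_dist_cong:
  assumes "\<And>n \<omega>. \<omega> \<in> space \<Omega> \<Longrightarrow> X n \<omega> = Y n \<omega>" and "g = h"
  shows "conv_in_dist \<Omega> X \<mu> g \<longleftrightarrow> conv_in_dist \<Omega> Y \<mu> h"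
proof -
  have "(\<integral>\<omega>. f (X n \<omega>) \<partial>\<Omega>) = (\<integral>\<omega>. f (Y n \<omega>) \<partial>\<Omega>)" for f :: "_ \<Rightarrow> real" and n
    using assms by (intro Bochner_Integration.integral_cong) auto
  then show ?thesis unfolding conv_in_dist_def \<open>g = h\<close> by simp
qed

lemma conv_in_prob_continuous_map:
  fixes X :: "nat \<Rightarrow> 'w \<Rightarrow> 'a::{metric_space, second_countable_topology}" and f :: "'a \<Rightarrow> 'b::metric_space"
  assumes "prob_space \<Omega>" and X: "\<And>n. X n \<in> borel_measurable \<Omega>"
    and lim: "conv_in_prob \<Omega> X c" and f: "isCont f c"
  shows "conv_in_prob \<Omega> (\<lambda>n \<omega>. f (X n \<omega>)) (f c)"
  unfolding conv_in_prob_def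
proof (intro allI impI)
  interpret prob_space \<Omega> by fact
  fix e :: real assume "e > 0"
  then obtain d where d: "d > 0" "\<And>x. dist x c < d \<Longrightarrow> dist (f x) (f c) < e"
    using f unfolding continuous_at_eps_delta by blast
  have [measurable]: "X n \<in> borel_measurable \<Omega>" for n by (rule X)
  have le: "prob {\<omega> \<in> space \<Omega>. dist (f (X n \<omega>)) (f c) > e} \<le> prob {\<omega> \<in> space \<Omega>. dist (X n \<omega>) c > d / 2}" for n
  proof (rule finite_measure_mono)
    show "{\<omega> \<in> space \<Omega>. dist (f (X n \<omega>)) (f c) > e} \<subseteq> {\<omega> \<in> space \<Omega>. dist (X n \<omega>) c > d / 2}"
    proof safe
      fix \<omega> assume "e < dist (f (X n \<omega>)) (f c)"
      then have "\<not> dist (X n \<omega>) c < d" using d(2)[of "X n \<omega>"] by linarith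
      then show "d / 2 < dist (X n \<omega>) c" using \<open>d > 0\<close> by linarith
    qed
  qed measurable
  have "(\<lambda>n. prob {\<omega> \<in> space \<Omega>. dist (X n \<omega>) c > d / 2}) \<longlonglongrightarrow> 0"
    using lim half_gt_zero[OF d(1)] unfolding conv_in_prob_def by blast
  then show "(\<lambda>n. prob {\<omega> \<in> space \<Omega>. dist (f (X n \<omega>)) (f c) > e}) \<longlonglongrightarrow> 0"
    by (rule Lim_null_comparison[rotated]) (use le in auto)
qed

text \<open>The norm is at most the sum of the absolute coordinates, so a deviation beyond
  \<open>e\<close> forces some coordinate to deviate beyond \<open>e / DIM('a)\<close>; a union
  bound over the finite basis finishes.\<close>

lemma conv_in_prob_euclidean:
  fixes X :: "nat \<Rightarrow> 'w \<Rightarrow> 'a::euclidean_space"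
  assumes "prob_space \<Omega>" and X: "\<And>n. X n \<in> borel_measurable \<Omega>"
    and lim: "\<And>i. i \<in> Basis \<Longrightarrow> conv_in_prob \<Omega> (\<lambda>n \<omega>. X n \<omega> \<bullet> i) (c \<bullet> i)"
  shows "conv_in_prob \<Omega> X c"
  unfolding conv_in_prob_def
proof (intro allI impI)
  interpret prob_space \<Omega> by fact
  fix e :: real assume "e > 0"
  define d where "d = e / DIM('a)"
  have "d > 0" using \<open>e > 0\<close> by (simp add: d_def)
  have [measurable]: "X n \<in> borel_measurable \<Omega>" for n by (rule X)
  have le: "prob {\<omega> \<in> space \<Omega>. dist (X n \<omega>) c > e}
     \<le> (\<Sum>i\<in>Basis. prob {\<omega> \<in> space \<Omega>. dist (X n \<omega> \<bullet> i) (c \<bullet> i) > d})" for n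
  proof -
    have "{\<omega> \<in> space \<Omega>. dist (X n \<omega>) c > e} \<subseteq> (\<Union>i\<in>Basis. {\<omega> \<in> space \<Omega>. dist (X n \<omega> \<bullet> i) (c \<bullet> i) > d})"
    proof (rule subsetI, rule ccontr)
      fix \<omega> assume \<omega>: "\<omega> \<in> {\<omega> \<in> space \<Omega>. dist (X n \<omega>) c > e}"
        and "\<omega> \<notin> (\<Union>i\<in>Basis. {\<omega> \<in> space \<Omega>. dist (X n \<omega> \<bullet> i) (c \<bullet> i) > d})"
      then have "\<bar>(X n \<omega> - c) \<bullet> i\<bar> \<le> d" if "i \<in> Basis" for i
        using that by (auto simp: dist_real_def inner_diff_left not_less)
      then have "norm (X n \<omega> - c) \<le> (\<Sum>i\<in>(Basis::'a set). d)"
        by (intro order_trans[OF norm_le_l1] sum_mono)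
      then show False using \<omega> by (simp add: d_def dist_norm)
    qed
    then have "prob {\<omega> \<in> space \<Omega>. dist (X n \<omega>) c > e}
      \<le> prob (\<Union>i\<in>Basis. {\<omega> \<in> space \<Omega>. dist (X n \<omega> \<bullet> i) (c \<bullet> i) > d})"
      by (rule finite_measure_mono) (intro sets.finite_UN finite_Basis, measurable)
    also have "\<dots> \<le> (\<Sum>i\<in>Basis. prob {\<omega> \<in> space \<Omega>. dist (X n \<omega> \<bullet> i) (c \<bullet> i) > d})"
      by (intro finite_measure_subadditive_finite) auto
    finally show ?thesis .
  qed
  have "(\<lambda>n. \<Sum>i\<in>(Basis::'a set). prob {\<omega> \<in> space \<Omega>. dist (X n \<omega> \<bullet> i) (c \<bullet> i) > d}) \<longlonglongrightarrow> 0"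
    using lim \<open>d > 0\<close> unfolding conv_in_prob_def by (intro tendsto_null_sum) auto
  then show "(\<lambda>n. prob {\<omega> \<in> space \<Omega>. dist (X n \<omega>) c > e}) \<longlonglongrightarrow> 0"
    by (rule Lim_null_comparison[rotated]) (use le in auto)
qed

lemma conv_in_prob_Pair:
  fixes X :: "nat \<Rightarrow> 'w \<Rightarrow> 'a::euclidean_space" and Y :: "nat \<Rightarrow> 'w \<Rightarrow> 'b::euclidean_space"
  assumes "prob_space \<Omega>" and X: "\<And>n. X n \<in> borel_measurable \<Omega>" and Y: "\<And>n. Y n \<in> borel_measurable \<Omega>"
    and lim: "conv_in_prob \<Omega> X c" "conv_in_prob \<Omega> Y d"
  shows "conv_in_prob \<Omega> (\<lambda>n \<omega>. (X n \<omega>, Y n \<omega>)) (c, d)"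
proof (rule conv_in_prob_euclidean[OF \<open>prob_space \<Omega>\<close>])
  fix i :: "'a \<times> 'b" assume "i \<in> Basis"
  then consider u where "i = (u, 0)" | v where "i = (0, v)"
    by (auto simp: Basis_prod_def)
  then show "conv_in_prob \<Omega> (\<lambda>n \<omega>. (X n \<omega>, Y n \<omega>) \<bullet> i) ((c, d) \<bullet> i)"
  proof cases
    case 1
    then show ?thesis
      using conv_in_prob_continuous_map[OF \<open>prob_space \<Omega>\<close> X lim(1), of "\<lambda>x. x \<bullet> u"] by simp
  next
    case 2
    then show ?thesis
      using conv_in_prob_continuous_map[OF \<open>prob_space \<Omega>\<close> Y lim(2), of "\<lambda>y. y \<bullet> v"] by simp
  qed
qed (use X Y in auto)

text \<open>Chebyshev's inequality around \<open>c\<close>. At \<open>n = 0\<close> the right-hand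
  side would be 0, hence the assumptions only for positive \<open>n\<close>.\<close>

lemma conv_in_prob_L2:
  fixes X :: "nat \<Rightarrow> 'w \<Rightarrow> real"
  assumes "prob_space \<Omega>" and X: "\<And>n. X n \<in> borel_measurable \<Omega>"
    and int: "\<And>n. n > 0 \<Longrightarrow> integrable \<Omega> (\<lambda>\<omega>. (X n \<omega> - c)\<^sup>2)"
    and le: "\<And>n. n > 0 \<Longrightarrow> (\<integral>\<omega>. (X n \<omega> - c)\<^sup>2 \<partial>\<Omega>) \<le> V / real n"
  shows "conv_in_prob \<Omega> X c"
  unfolding conv_in_prob_def
proof (intro allI impI)
  interpret prob_space \<Omega> by fact
  fix e :: real assume "e > 0"
  have [measurable]: "X n \<in> borel_measurable \<Omega>" for n by (rule X)
  have "prob {\<omega> \<in> space \<Omega>. dist (X n \<omega>) c > e} \<le> V / e\<^sup>2 / real n" if "n > 0" for n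
  proof -
    have "prob {\<omega> \<in> space \<Omega>. dist (X n \<omega>) c > e} \<le> prob {\<omega> \<in> space \<Omega>. \<bar>X n \<omega> - c\<bar> \<ge> e}"
      by (intro finite_measure_mono) (auto simp: dist_real_def)
    also have "\<dots> \<le> (\<integral>\<omega>. (X n \<omega> - c)\<^sup>2 \<partial>\<Omega>) / e\<^sup>2"
      using \<open>e > 0\<close> int that by (intro second_moment_method) auto
    also have "\<dots> \<le> V / real n / e\<^sup>2"
      using le[OF that] by (intro divide_right_mono) auto
    finally show ?thesis by (simp add: mult.commute)
  qed
  then have ev: "\<forall>\<^sub>F n in sequentially. norm (prob {\<omega> \<in> space \<Omega>. dist (X n \<omega>) c > e}) \<le> V / e\<^sup>2 / real n"
    by (intro eventually_sequentiallyI[of 1]) simp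
  have "(\<lambda>n. V / e\<^sup>2 / real n) \<longlonglongrightarrow> 0"
    by (rule lim_const_over_n)
  then show "(\<lambda>n. prob {\<omega> \<in> space \<Omega>. dist (X n \<omega>) c > e}) \<longlonglongrightarrow> 0"
    by (rule Lim_null_comparison[OF ev])
qed

text \<open>Continuity of the measure from above: the tail events decrease to the empty set along
  integer radii.\<close>

lemma (in prob_space) tight_borel:
  fixes X :: "'a \<Rightarrow> 'b::real_normed_vector"
  assumes [measurable]: "X \<in> borel_measurable M" and "e > 0"
  obtains r where "r > 0" "prob {\<omega> \<in> space M. norm (X \<omega>) > r} < e"
proof -
  have "(\<lambda>n. prob {\<omega> \<in> space M. norm (X \<omega>) > real n}) \<longlonglongrightarrow> prob (\<Inter>n. {\<omega> \<in> space M. norm (X \<omega>) > real n})"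
    by (intro finite_Lim_measure_decseq) (auto simp: decseq_def)
  also have "(\<Inter>n. {\<omega> \<in> space M. norm (X \<omega>) > real n}) = {}"
    using reals_Archimedean2 by (auto simp: set_eq_iff not_less intro: less_imp_le)
  finally have "\<forall>\<^sub>F n in sequentially. prob {\<omega> \<in> space M. norm (X \<omega>) > real n} < e"
    using \<open>e > 0\<close> by (auto intro: order_tendstoD)
  then have "\<forall>\<^sub>F n in sequentially. prob {\<omega> \<in> space M. norm (X \<omega>) > real n} < e \<and> n > 0"
    using eventually_gt_at_top[of 0] by eventually_elim auto
  then obtain n where "prob {\<omega> \<in> space M. norm (X \<omega>) > real n} < e" "n > 0"
    by (auto dest: eventually_happens)
  then show thesis by (intro that[of "real n"]) auto
qed

text \<open>Because \<open>B n\<close> has one and the same law for all positive \<open>n\<close>,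
  replacing \<open>G n\<close> by \<open>c\<close> already gives the limit integral exactly. Only
  the cost of this replacement must vanish, and tightness of the single variable \<open>g\<close>
  controls all \<open>B n\<close> at once.\<close>

lemma conv_in_dist_slutsky:
  fixes B :: "nat \<Rightarrow> 'w \<Rightarrow> 'a::euclidean_space" and G :: "nat \<Rightarrow> 'w \<Rightarrow> 'b::euclidean_space"
    and F :: "'a \<times> 'b \<Rightarrow> 'c::metric_space"
  assumes "prob_space \<Omega>" "prob_space \<mu>"
    and B: "\<And>n. B n \<in> borel_measurable \<Omega>" and G: "\<And>n. G n \<in> borel_measurable \<Omega>"
    and g: "g \<in> borel_measurable \<mu>"
    and law: "\<And>n. n > 0 \<Longrightarrow> distr \<Omega> borel (B n) = distr \<mu> borel g"
    and lim: "conv_in_prob \<Omega> G c"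
    and F: "continuous_on UNIV F"
  shows "conv_in_dist \<Omega> (\<lambda>n \<omega>. F (B n \<omega>, G n \<omega>)) \<mu> (\<lambda>e. F (g e, c))"
  unfolding conv_in_dist_def
proof (intro allI impI)
  interpret prob_space \<Omega> by fact
  interpret \<mu>: prob_space \<mu> by fact
  fix f :: "'c \<Rightarrow> real" assume f: "continuous_on UNIV f \<and> bounded (range f)"
  define h where "h p = f (F p)" for p
  have h: "continuous_on UNIV h"
    unfolding h_def using f by (intro continuous_on_compose2[OF _ F, of UNIV f]) auto
  obtain H where H: "H > 0" "\<And>p. \<bar>h p\<bar> \<le> H"
    using f unfolding bounded_pos h_def by auto
  note [measurable] = B G g borel_measurable_continuous_onI[OF h]
  have meas_c [measurable]: "(\<lambda>b. h (b, c)) \<in> borel_measurable borel"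
    by (intro borel_measurable_continuous_onI continuous_on_compose2[OF h] continuous_intros) auto
  have meas_p [measurable]: "(\<lambda>\<omega>. h (B n \<omega>, G n \<omega>)) \<in> borel_measurable \<Omega>" for n
    by measurable
  have int: "integrable \<Omega> (\<lambda>\<omega>. h (B n \<omega>, G n \<omega>))" "integrable \<Omega> (\<lambda>\<omega>. h (B n \<omega>, c))" for n
    using H by (auto intro!: integrable_const_bound[where B=H])
  have eq: "(\<integral>\<omega>. h (B n \<omega>, c) \<partial>\<Omega>) = (\<integral>e. h (g e, c) \<partial>\<mu>)" if "n > 0" for n
    using integral_distr[of "B n" \<Omega> borel "\<lambda>b. h (b, c)"] integral_distr[of g \<mu> borel "\<lambda>b. h (b, c)"] law[OF that]
    by simp
  have "(\<lambda>n. (\<integral>\<omega>. h (B n \<omega>, G n \<omega>) \<partial>\<Omega>)) \<longlonglongrightarrow> (\<integral>e. h (g e, c) \<partial>\<mu>)"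
  proof (rule LIMSEQ_I)
    fix e :: real assume "e > 0"
    \<comment> \<open>The good event costs \<open>e'\<close> and each of the two bad events at most
      \<open>2 * H * e'\<close>. The total \<open>e' * (1 + 4 * H)\<close> stays strictly below
      \<open>e\<close>.\<close>
    define e' where "e' = e / (2 + 4 * H)"
    have e': "e' > 0" "e' * (2 + 4 * H) = e" using \<open>e > 0\<close> H by (auto simp: e'_def)
    obtain r where r: "r > 0" "\<mu>.prob {x \<in> space \<mu>. norm (g x) > r} < e'"
      using \<mu>.tight_borel[OF g] e' by blast
    have tail: "prob {\<omega> \<in> space \<Omega>. norm (B n \<omega>) > r} < e'" if "n > 0" for n
    proof -
      have "prob {\<omega> \<in> space \<Omega>. norm (B n \<omega>) > r} = measure (distr \<Omega> borel (B n)) {b. norm b > r}"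
        by (subst measure_distr) (auto intro!: arg_cong[where f=prob])
      also have "\<dots> = \<mu>.prob {x \<in> space \<mu>. norm (g x) > r}"
        unfolding law[OF that] by (subst measure_distr) (auto intro!: arg_cong[where f=\<mu>.prob])
      finally show ?thesis using r by simp
    qed
    \<comment> \<open>\<open>h\<close> need not be uniformly continuous globally; it is so on this
      compact box, which contains \<open>(B n, G n)\<close> and \<open>(B n, c)\<close> outside the
      bad events.\<close>
    have "compact (cball (0::'a) r \<times> cball c 1)" by (intro compact_Times compact_cball)
    then have "uniformly_continuous_on (cball (0::'a) r \<times> cball c 1) h"
      by (intro compact_uniformly_continuous continuous_on_subset[OF h]) auto
    then obtain d where d: "d > 0" "\<And>p q. p \<in> cball 0 r \<times> cball c 1 \<Longrightarrow> q \<in> cball 0 r \<times> cball c 1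
        \<Longrightarrow> dist q p < d \<Longrightarrow> dist (h q) (h p) < e'"
      using e' unfolding uniformly_continuous_on_def by metis
    \<comment> \<open>The bound 1 keeps \<open>G n\<close> in the box, and \<open>d / 2\<close>
      gives a distance strictly below \<open>d\<close>.\<close>
    define \<delta> where "\<delta> = min (d / 2) 1"
    have \<delta>: "\<delta> > 0" using d by (simp add: \<delta>_def)
    have "(\<lambda>n. prob {\<omega> \<in> space \<Omega>. dist (G n \<omega>) c > \<delta>}) \<longlonglongrightarrow> 0"
      using lim \<delta> unfolding conv_in_prob_def by simp
    then have "\<forall>\<^sub>F n in sequentially. prob {\<omega> \<in> space \<Omega>. dist (G n \<omega>) c > \<delta>} < e'"
      using e' by (auto intro: order_tendstoD)
    then obtain N where N: "\<And>n. n \<ge> N \<Longrightarrow> prob {\<omega> \<in> space \<Omega>. dist (G n \<omega>) c > \<delta>} < e'"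
      by (auto simp: eventually_sequentially)
    have "norm ((\<integral>\<omega>. h (B n \<omega>, G n \<omega>) \<partial>\<Omega>) - (\<integral>e. h (g e, c) \<partial>\<mu>)) < e" if n: "n \<ge> Suc N" for n
    proof -
      let ?S = "{\<omega> \<in> space \<Omega>. norm (B n \<omega>) > r}" and ?T = "{\<omega> \<in> space \<Omega>. dist (G n \<omega>) c > \<delta>}"
      let ?D = "\<lambda>\<omega>. h (B n \<omega>, G n \<omega>) - h (B n \<omega>, c)"
      let ?R = "\<lambda>\<omega>. e' + 2 * H * indicator ?S \<omega> + 2 * H * indicator ?T \<omega>"
      have pw: "\<bar>?D \<omega>\<bar> \<le> ?R \<omega>" if \<omega>: "\<omega> \<in> space \<Omega>" for \<omega>
      proof (cases "\<omega> \<in> ?S \<or> \<omega> \<in> ?T")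
        case True
        have "\<bar>?D \<omega>\<bar> \<le> 2 * H" using H(2)[of "(B n \<omega>, G n \<omega>)"] H(2)[of "(B n \<omega>, c)"] by linarith
        then show ?thesis using True e' H(1) by (auto simp: indicator_def)
      next
        case False
        then have le: "norm (B n \<omega>) \<le> r" "dist (G n \<omega>) c \<le> \<delta>" using \<omega> by auto
        have "dist (h (B n \<omega>, G n \<omega>)) (h (B n \<omega>, c)) < e'"
        proof (rule d(2))
          show "dist (B n \<omega>, G n \<omega>) (B n \<omega>, c) < d"
            using le d by (simp add: dist_Pair_Pair \<delta>_def)
        qed (use le in \<open>auto simp: \<delta>_def dist_commute\<close>)
        then show ?thesis using False by (simp add: dist_real_def)
      qed
      have intR: "integrable \<Omega> (indicator ?S :: _ \<Rightarrow> real)" "integrable \<Omega> (indicator ?T :: _ \<Rightarrow> real)"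
        by (auto simp: integrable_indicator_iff emeasure_eq_measure)
      have "(\<integral>\<omega>. h (B n \<omega>, G n \<omega>) \<partial>\<Omega>) - (\<integral>e. h (g e, c) \<partial>\<mu>) = (\<integral>\<omega>. ?D \<omega> \<partial>\<Omega>)"
        using n int eq[of n] by simp
      also have "\<bar>\<dots>\<bar> \<le> (\<integral>\<omega>. \<bar>?D \<omega>\<bar> \<partial>\<Omega>)"
        using integral_norm_bound[of \<Omega> ?D] by simp
      also have "\<dots> \<le> (\<integral>\<omega>. ?R \<omega> \<partial>\<Omega>)"
        using int intR pw by (intro integral_mono) auto
      also have "\<dots> = e' + 2 * H * prob ?S + 2 * H * prob ?T"
        using intR by (simp add: prob_space)
      also have "\<dots> \<le> e' + 2 * H * e' + 2 * H * e'"
        using tail[of n] N[of n] n H by (intro add_mono mult_left_mono) auto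
      also have "\<dots> < e' * (2 + 4 * H)" using e' by (simp add: algebra_simps)
      finally show ?thesis using e' by simp
    qed
    then show "\<exists>no. \<forall>n\<ge>no. norm ((\<integral>\<omega>. h (B n \<omega>, G n \<omega>) \<partial>\<Omega>) - (\<integral>e. h (g e, c) \<partial>\<mu>)) < e"
      by blast
  qed
  then show "(\<lambda>n. \<integral>\<omega>. f (F (B n \<omega>, G n \<omega>)) \<partial>\<Omega>) \<longlonglongrightarrow> (\<integral>e. f (F (g e, c)) \<partial>\<mu>)"
    by (simp add: h_def)
qed

section \<open>Moments of independent sums and of normal variables\<close>

lemma (in prob_space) indep_vars_mult:
  fixes Y :: "'i \<Rightarrow> 'a \<Rightarrow> real"
  assumes "indep_vars (\<lambda>_. borel) Y I" "i \<in> I" "j \<in> I" "i \<noteq> j" "integrable M (Y i)" "integrable M (Y j)"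
  shows "integrable M (\<lambda>\<omega>. Y i \<omega> * Y j \<omega>)"
    and "expectation (\<lambda>\<omega>. Y i \<omega> * Y j \<omega>) = expectation (Y i) * expectation (Y j)"
  using indep_vars_integrable[of "{i, j}" Y] indep_vars_lebesgue_integral[of "{i, j}" Y]
    indep_vars_subset[OF assms(1), of "{i, j}"] assms by auto

text \<open>Expanding the square, independence and centering annihilate every off-diagonal
  expectation, leaving \<open>card I\<close> diagonal terms of size at most
  \<open>V\<close>.\<close>

lemma (in prob_space) centered_sum_second_moment:
  fixes Y :: "'i \<Rightarrow> 'a \<Rightarrow> real" and V :: real
  assumes "finite I" and ind: "indep_vars (\<lambda>_. borel) Y I"
    and int: "\<And>i. i \<in> I \<Longrightarrow> integrable M (Y i)" "\<And>i. i \<in> I \<Longrightarrow> integrable M (\<lambda>\<omega>. (Y i \<omega>)\<^sup>2)"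
    and mean: "\<And>i. i \<in> I \<Longrightarrow> expectation (Y i) = 0"
    and var: "\<And>i. i \<in> I \<Longrightarrow> expectation (\<lambda>\<omega>. (Y i \<omega>)\<^sup>2) \<le> V"
  shows "integrable M (\<lambda>\<omega>. (\<Sum>i\<in>I. Y i \<omega>)\<^sup>2)"
    and "expectation (\<lambda>\<omega>. (\<Sum>i\<in>I. Y i \<omega>)\<^sup>2) \<le> card I * V"
proof -
  have sq: "(\<Sum>i\<in>I. Y i \<omega>)\<^sup>2 = (\<Sum>i\<in>I. \<Sum>j\<in>I. Y i \<omega> * Y j \<omega>)" for \<omega>
    by (simp add: power2_eq_square sum_product)
  have *: "integrable M (\<lambda>\<omega>. Y i \<omega> * Y j \<omega>) \<and>
      expectation (\<lambda>\<omega>. Y i \<omega> * Y j \<omega>) \<le> (if j = i then V else 0)" if "i \<in> I" "j \<in> I" for i j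
  proof (cases "j = i")
    case True
    then show ?thesis using int var that by (simp add: power2_eq_square)
  next
    case False
    then show ?thesis
      using indep_vars_mult[OF ind that] int mean that by auto
  qed
  show "integrable M (\<lambda>\<omega>. (\<Sum>i\<in>I. Y i \<omega>)\<^sup>2)"
    unfolding sq using * by (intro Bochner_Integration.integrable_sum) auto
  have "expectation (\<lambda>\<omega>. (\<Sum>i\<in>I. Y i \<omega>)\<^sup>2) = (\<Sum>i\<in>I. \<Sum>j\<in>I. expectation (\<lambda>\<omega>. Y i \<omega> * Y j \<omega>))"
    unfolding sq using * by (simp add: Bochner_Integration.integral_sum Bochner_Integration.integrable_sum)
  also have "\<dots> \<le> (\<Sum>i\<in>I. \<Sum>j\<in>I. if j = i then V else 0)"
    using * by (intro sum_mono) auto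
  also have "\<dots> = card I * V" using \<open>finite I\<close> by simp
  finally show "expectation (\<lambda>\<omega>. (\<Sum>i\<in>I. Y i \<omega>)\<^sup>2) \<le> card I * V" .
qed

lemma (in prob_space) std_normal_even_moment:
  assumes D: "distributed M lborel X std_normal_density"
  shows "integrable M (\<lambda>\<omega>. X \<omega> ^ (2 * k))"
    and "expectation (\<lambda>\<omega>. X \<omega> ^ (2 * k)) = fact (2 * k) / (2 ^ k * fact k)"
  using std_normal_moment_even[of k] distributed_integrable[OF D, of "\<lambda>x. x ^ (2 * k)"]
    distributed_integral[OF D, of "\<lambda>x. x ^ (2 * k)"]
  by (auto simp: has_bochner_integral_iff)

subsection \<open>Gaussian heads\<close>

lemma borel_measurable_vec_lambda:
  fixes f :: "'a \<Rightarrow> 'k::finite \<Rightarrow> real"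
  assumes "\<And>k. (\<lambda>x. f x k) \<in> borel_measurable M"
  shows "(\<lambda>x. \<chi> k. f x k) \<in> borel_measurable M"
  using assms
  by (subst borel_measurable_euclidean_space) (auto simp: Basis_vec_def inner_axis)

text \<open>A common normal form for one fixed number of heads: after division by the standard
  deviation both regimes have standard normal entries, so one set of estimates serves both.\<close>

definition gaussian_heads :: "'w measure \<Rightarrow> nat \<Rightarrow> (nat \<Rightarrow> 'w \<Rightarrow> real^'k) \<Rightarrow> bool" where
  "gaussian_heads \<Omega> M z \<longleftrightarrow>
     prob_space.indep_vars \<Omega> (\<lambda>_. borel) (\<lambda>(m, k) \<omega>. z m \<omega> $ k) ({..<M} \<times> UNIV)
     \<and> (\<forall>m<M. \<forall>k. distributed \<Omega> lborel (\<lambda>\<omega>. z m \<omega> $ k) std_normal_density)"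

context prob_space
begin

lemma std_normal_moments:
  assumes D: "distributed M lborel X std_normal_density"
  shows "X \<in> borel_measurable M" "integrable M X" "expectation X = 0"
    and "integrable M (\<lambda>\<omega>. (X \<omega>)\<^sup>2)" "expectation (\<lambda>\<omega>. (X \<omega>)\<^sup>2) = 1"
    and "integrable M (\<lambda>\<omega>. X \<omega> ^ 4)" "expectation (\<lambda>\<omega>. X \<omega> ^ 4) = 3"
proof -
  show X: "X \<in> borel_measurable M"
    using distributed_measurable[OF D] by simp
  show "expectation X = 0"
    by (rule standard_normal_distributed_expectation[OF D])
  show int2: "integrable M (\<lambda>\<omega>. (X \<omega>)\<^sup>2)"
    using std_normal_even_moment(1)[OF D, of 1] by simp
  show "integrable M X"
    using square_integrable_imp_integrable[OF X int2] .
  show "expectation (\<lambda>\<omega>. (X \<omega>)\<^sup>2) = 1"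
    using std_normal_even_moment(2)[OF D, of 1] by simp
  show "integrable M (\<lambda>\<omega>. X \<omega> ^ 4)"
    using std_normal_even_moment(1)[OF D, of 2] by simp
  show "expectation (\<lambda>\<omega>. X \<omega> ^ 4) = 3"
    using std_normal_even_moment(2)[OF D, of 2] by (simp add: fact_numeral)
qed

lemma gaussian_heads_measurable:
  assumes "gaussian_heads M N z" "m < N"
  shows "z m \<in> borel_measurable M"
proof -
  have "(\<lambda>\<omega>. \<chi> k. z m \<omega> $ k) \<in> borel_measurable M"
    using assms distributed_measurable[of M lborel "\<lambda>\<omega>. z m \<omega> $ k" std_normal_density for k]
    by (intro borel_measurable_vec_lambda) (auto simp: gaussian_heads_def)
  then show ?thesis by simp
qed

text \<open>Entries are independent over all pairs \<open>(m, k)\<close>. Grouping them by head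
  gives disjoint index blocks, so the heads, and any Borel function of each, are
  independent.\<close>

lemma gaussian_heads_indep:
  assumes z: "gaussian_heads M N (z :: nat \<Rightarrow> 'a \<Rightarrow> real^'k)" and g: "g \<in> borel_measurable borel"
  shows "indep_vars (\<lambda>_. borel) (\<lambda>m \<omega>. g (z m \<omega>)) {..<N}"
proof -
  let ?Z = "\<lambda>(m, k) \<omega>. z m \<omega> $ k"
  have "indep_vars (\<lambda>m. PiM ({m} \<times> UNIV) (\<lambda>_. borel)) (\<lambda>m \<omega>. restrict (\<lambda>i. ?Z i \<omega>) ({m} \<times> UNIV)) {..<N}"
    using z by (intro indep_vars_restrict[of "\<lambda>_. borel" ?Z "{..<N} \<times> UNIV"])
      (auto simp: gaussian_heads_def disjoint_family_on_def)
  then have "indep_vars (\<lambda>_. borel) (\<lambda>m \<omega>. (\<lambda>f. g (\<chi> k. f (m, k))) (restrict (\<lambda>i. ?Z i \<omega>) ({m} \<times> UNIV))) {..<N}"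
    by (rule indep_vars_compose2)
       (intro measurable_compose[OF _ g] borel_measurable_vec_lambda measurable_component_singleton, auto)
  then show ?thesis by simp
qed

lemma gaussian_heads_mean_second_moment:
  assumes z: "gaussian_heads M N (z :: nat \<Rightarrow> 'a \<Rightarrow> real^'k)" and "N > 0"
    and g: "g \<in> borel_measurable borel"
    and int: "\<And>m. m < N \<Longrightarrow> integrable M (\<lambda>\<omega>. g (z m \<omega>))" "\<And>m. m < N \<Longrightarrow> integrable M (\<lambda>\<omega>. (g (z m \<omega>))\<^sup>2)"
    and mean: "\<And>m. m < N \<Longrightarrow> expectation (\<lambda>\<omega>. g (z m \<omega>)) = 0"
    and var: "\<And>m. m < N \<Longrightarrow> expectation (\<lambda>\<omega>. (g (z m \<omega>))\<^sup>2) \<le> V"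
  shows "integrable M (\<lambda>\<omega>. ((\<Sum>m<N. g (z m \<omega>)) / N)\<^sup>2)"
    and "expectation (\<lambda>\<omega>. ((\<Sum>m<N. g (z m \<omega>)) / N)\<^sup>2) \<le> V / N"
proof -
  note * = centered_sum_second_moment[OF finite_lessThan gaussian_heads_indep[OF z g], of V]
  show "integrable M (\<lambda>\<omega>. ((\<Sum>m<N. g (z m \<omega>)) / N)\<^sup>2)"
    unfolding power_divide using * int mean var by auto
  have "expectation (\<lambda>\<omega>. (\<Sum>m<N. g (z m \<omega>))\<^sup>2) / N\<^sup>2 \<le> (N * V) / N\<^sup>2"
    using * int mean var by (intro divide_right_mono) auto
  then show "expectation (\<lambda>\<omega>. ((\<Sum>m<N. g (z m \<omega>)) / N)\<^sup>2) \<le> V / N"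
    using \<open>N > 0\<close> unfolding power_divide by (simp add: power2_eq_square)
qed

lemma gaussian_heads_mean:
  assumes z: "gaussian_heads M N (z :: nat \<Rightarrow> 'a \<Rightarrow> real^'k)" and "N > 0"
  shows "integrable M (\<lambda>\<omega>. ((\<Sum>m<N. z m \<omega> $ k) / N)\<^sup>2)"
    and "expectation (\<lambda>\<omega>. ((\<Sum>m<N. z m \<omega> $ k) / N)\<^sup>2) \<le> 1 / N"
proof -
  have std: "distributed M lborel (\<lambda>\<omega>. z m \<omega> $ k) std_normal_density" if "m < N" for m
    using z that by (simp add: gaussian_heads_def)
  note * = std_normal_moments[OF std]
  note gaussian_heads_mean_second_moment[OF z \<open>N > 0\<close>, where g="\<lambda>v. v $ k" and V=1, OF _ *(2,4,3)]
  then show "integrable M (\<lambda>\<omega>. ((\<Sum>m<N. z m \<omega> $ k) / N)\<^sup>2)"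
    and "expectation (\<lambda>\<omega>. ((\<Sum>m<N. z m \<omega> $ k) / N)\<^sup>2) \<le> 1 / N"
    using *(5) by simp_all
qed

text \<open>The function \<open>g\<close> is centered: two distinct entries of one head are
  independent with mean 0, and a single entry has variance 1. Averages of \<open>g\<close> over
  independent heads then have second moment of order \<open>1 / N\<close>.\<close>

lemma gaussian_heads_gram:
  assumes z: "gaussian_heads M N (z :: nat \<Rightarrow> 'a \<Rightarrow> real^'k)" and "N > 0"
  shows "integrable M (\<lambda>\<omega>. ((\<Sum>m<N. z m \<omega> $ k * z m \<omega> $ l) / N - (if k = l then 1 else 0))\<^sup>2)"
    and "expectation (\<lambda>\<omega>. ((\<Sum>m<N. z m \<omega> $ k * z m \<omega> $ l) / N - (if k = l then 1 else 0))\<^sup>2) \<le> 8 / N"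
proof -
  define \<delta> :: real where "\<delta> = (if k = l then 1 else 0)"
  define g where "g v = v $ k * v $ l - \<delta>" for v :: "real^'k"
  have std: "distributed M lborel (\<lambda>\<omega>. z m \<omega> $ k) std_normal_density" if "m < N" for m k
    using z that by (simp add: gaussian_heads_def)
  note mom = std_normal_moments[OF std]
  have g: "g \<in> borel_measurable borel"
    unfolding g_def by (intro borel_measurable_continuous_onI continuous_intros)
  have prod: "integrable M (\<lambda>\<omega>. z m \<omega> $ k * z m \<omega> $ l)"
      "expectation (\<lambda>\<omega>. z m \<omega> $ k * z m \<omega> $ l) = \<delta>" if m: "m < N" for m
  proof -
    have *: "integrable M (\<lambda>\<omega>. z m \<omega> $ k * z m \<omega> $ l) \<and> expectation (\<lambda>\<omega>. z m \<omega> $ k * z m \<omega> $ l) = \<delta>"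
    proof (cases "k = l")
      case True
      then show ?thesis using mom(4,5)[OF m, of l] by (simp add: \<delta>_def power2_eq_square)
    next
      case False
      then show ?thesis
        using indep_vars_mult[of "\<lambda>(m, k) \<omega>. z m \<omega> $ k" "{..<N} \<times> UNIV" "(m, k)" "(m, l)"] z mom(2,3)[OF m] m
        by (simp add: gaussian_heads_def \<delta>_def)
    qed
    then show "integrable M (\<lambda>\<omega>. z m \<omega> $ k * z m \<omega> $ l)"
      "expectation (\<lambda>\<omega>. z m \<omega> $ k * z m \<omega> $ l) = \<delta>" by auto
  qed
  \<comment> \<open>This crude pointwise bound treats diagonal and off-diagonal entries alike. Since
    standard normal fourth moments are 3, its expectation is \<open>3 + 3 + 2\<close>, the constant
    8 of the statement.\<close>
  have sq_le: "(g v)\<^sup>2 \<le> (v $ k) ^ 4 + (v $ l) ^ 4 + 2" for v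
  proof -
    have "(g v)\<^sup>2 \<le> 2 * (v $ k * v $ l)\<^sup>2 + 2 * \<delta>\<^sup>2"
      using zero_le_power2[of "v $ k * v $ l + \<delta>"] by (simp add: g_def power2_sum power2_diff)
    moreover have "2 * (v $ k * v $ l)\<^sup>2 \<le> (v $ k) ^ 4 + (v $ l) ^ 4"
      using zero_le_power2[of "(v $ k)\<^sup>2 - (v $ l)\<^sup>2"]
      by (simp add: power2_diff power_mult_distrib power4_eq_xxxx power2_eq_square algebra_simps)
    ultimately show ?thesis by (simp add: \<delta>_def split: if_splits)
  qed
  have intb: "integrable M (\<lambda>\<omega>. (z m \<omega> $ k) ^ 4 + (z m \<omega> $ l) ^ 4 + 2)" if "m < N" for m
    using mom(6)[OF that] by auto
  have int2: "integrable M (\<lambda>\<omega>. (g (z m \<omega>))\<^sup>2)" if "m < N" for m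
  proof (rule Bochner_Integration.integrable_bound[OF intb[OF that]])
    show "(\<lambda>\<omega>. (g (z m \<omega>))\<^sup>2) \<in> borel_measurable M"
      using measurable_compose[OF gaussian_heads_measurable[OF z that] g] by simp
  qed (use sq_le in \<open>auto intro!: AE_I2 intro: order_trans[OF _ abs_ge_self]\<close>)
  have "expectation (\<lambda>\<omega>. (g (z m \<omega>))\<^sup>2) \<le> 8" if "m < N" for m
  proof -
    have "expectation (\<lambda>\<omega>. (g (z m \<omega>))\<^sup>2) \<le> expectation (\<lambda>\<omega>. (z m \<omega> $ k) ^ 4 + (z m \<omega> $ l) ^ 4 + 2)"
      using sq_le by (intro integral_mono int2 intb that)
    also have "\<dots> = 8" using mom(6,7)[OF that] by (simp add: prob_space)
    finally show ?thesis .
  qed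
  moreover have "integrable M (\<lambda>\<omega>. g (z m \<omega>))" "expectation (\<lambda>\<omega>. g (z m \<omega>)) = 0" if "m < N" for m
    using prod[OF that] by (auto simp: g_def prob_space)
  moreover have "(\<Sum>m<N. g (z m \<omega>)) / N = (\<Sum>m<N. z m \<omega> $ k * z m \<omega> $ l) / N - \<delta>" for \<omega>
    using \<open>N > 0\<close> by (simp add: g_def sum_subtractf diff_divide_distrib)
  ultimately show "integrable M (\<lambda>\<omega>. ((\<Sum>m<N. z m \<omega> $ k * z m \<omega> $ l) / N - (if k = l then 1 else 0))\<^sup>2)"
    and "expectation (\<lambda>\<omega>. ((\<Sum>m<N. z m \<omega> $ k * z m \<omega> $ l) / N - (if k = l then 1 else 0))\<^sup>2) \<le> 8 / N"
    using gaussian_heads_mean_second_moment[OF z \<open>N > 0\<close> g, where V=8] int2 unfolding \<delta>_def[symmetric] by simp_all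
qed

text \<open>Normal laws are stable under independent sums, so every coordinate of the rescaled sum
  is exactly standard normal. The coordinates are independent because they use disjoint columns of
  entries, and independence makes the joint law the product of the marginals.\<close>

lemma gaussian_heads_sum_law:
  assumes z: "gaussian_heads M N (z :: nat \<Rightarrow> 'a \<Rightarrow> real^'k)" and "N > 0"
  shows "distr M borel (\<lambda>\<omega>. (1 / sqrt N) *\<^sub>R (\<Sum>m<N. z m \<omega>)) = distr std_gauss borel (\<lambda>e. \<chi> k. e k)"
proof -
  let ?Z = "\<lambda>(m, k) \<omega>. z m \<omega> $ k"
  define b where "b k \<omega> = (\<Sum>m<N. z m \<omega> $ k) / sqrt N" for k \<omega>
  have ind: "indep_vars (\<lambda>_. borel) ?Z ({..<N} \<times> UNIV)"
    and std: "\<And>m k. m < N \<Longrightarrow> distributed M lborel (\<lambda>\<omega>. z m \<omega> $ k) std_normal_density"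
    using z by (auto simp: gaussian_heads_def)
  \<comment> \<open>Here the entries are grouped by coordinate \<open>k\<close>, not by
    head.\<close>
  have "indep_vars (\<lambda>k. PiM ({..<N} \<times> {k}) (\<lambda>_. borel)) (\<lambda>k \<omega>. restrict (\<lambda>i. ?Z i \<omega>) ({..<N} \<times> {k})) UNIV"
    by (intro indep_vars_restrict[OF ind]) (auto simp: disjoint_family_on_def)
  then have "indep_vars (\<lambda>_. borel) (\<lambda>k \<omega>. (\<lambda>f. (\<Sum>m<N. f (m, k)) / sqrt N)
      (restrict (\<lambda>i. ?Z i \<omega>) ({..<N} \<times> {k}))) UNIV"
    by (rule indep_vars_compose2)
       (intro borel_measurable_divide borel_measurable_sum borel_measurable_const measurable_component_singleton, auto)
  then have indb: "indep_vars (\<lambda>_. borel) b UNIV"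
    by (simp add: b_def[abs_def])
  have law: "distributed M lborel (b k) std_normal_density" for k
  proof -
    have inj: "indep_vars (\<lambda>_. borel) (\<lambda>m \<omega>. z m \<omega> $ k) {..<N}"
      by (intro gaussian_heads_indep[OF z]) simp
    have "distributed M lborel (\<lambda>\<omega>. \<Sum>m<N. z m \<omega> $ k)
        (normal_density (\<Sum>m<N. 0) (sqrt (\<Sum>m<N. 1\<^sup>2)))"
      using \<open>N > 0\<close> std by (intro sum_indep_normal inj) auto
    then have "distributed M lborel (\<lambda>\<omega>. \<Sum>m<N. z m \<omega> $ k) (normal_density 0 (sqrt N))" by simp
    then show ?thesis
      using \<open>N > 0\<close> by (subst (asm) normal_standard_normal_convert) (auto simp: b_def[abs_def])
  qed
  have meas: "b k \<in> borel_measurable M" for k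
    using distributed_measurable[OF law] by simp
  have "distr M borel (b k) = density lborel std_normal_density" for k
    using distributed_distr_eq_density[OF law] by (simp cong: distr_cong)
  moreover have "distr M (PiM UNIV (\<lambda>_. borel)) (\<lambda>\<omega>. \<lambda>k\<in>UNIV. b k \<omega>) = PiM UNIV (\<lambda>k. distr M borel (b k))"
    using indep_vars_iff_distr_eq_PiM[of UNIV b "\<lambda>_. borel"] indb meas by simp
  ultimately have B: "distr M (PiM UNIV (\<lambda>_. borel)) (\<lambda>\<omega> k. b k \<omega>) = std_gauss"
    by (simp add: std_gauss_def restrict_def)
  \<comment> \<open>\<open>std_gauss\<close> is a measure on functions; this identifies its
    sigma-algebra with the Borel product, so that \<open>distr_distr\<close> can push it forward to
    vectors.\<close>
  have sets: "sets std_gauss = sets (PiM UNIV (\<lambda>_::'k. borel :: real measure))"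
    unfolding std_gauss_def by (rule sets_PiM_cong) auto
  have [measurable]: "(\<lambda>e :: 'k \<Rightarrow> real. \<chi> k. e k) \<in> PiM UNIV (\<lambda>_::'k. borel) \<rightarrow>\<^sub>M borel"
    by (rule borel_measurable_vec_lambda[of "\<lambda>e k. e k"]) simp
  have "distr std_gauss borel (\<lambda>e::'k\<Rightarrow>real. \<chi> k. e k) = distr M borel ((\<lambda>e. \<chi> k. e k) \<circ> (\<lambda>\<omega> k. b k \<omega>))"
    unfolding B[symmetric]
    by (rule distr_distr) (auto intro!: measurable_PiM_single' meas)
  also have "(\<lambda>e. \<chi> k. e k) \<circ> (\<lambda>\<omega> k. b k \<omega>) = (\<lambda>\<omega>. (1 / sqrt N) *\<^sub>R (\<Sum>m<N. z m \<omega>))"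
    by (auto simp: fun_eq_iff vec_eq_iff b_def)
  finally show ?thesis by simp
qed

end

section \<open>Limits of the head statistics and normalisation of the model\<close>

lemma head_stats_measurable:
  assumes "\<And>m. m < M \<Longrightarrow> w m \<in> borel_measurable \<Omega>"
  shows "(\<lambda>\<omega>. head_stats \<alpha> M (\<lambda>m. w m \<omega>)) \<in> borel_measurable \<Omega>"
proof -
  have "continuous_on UNIV (\<lambda>v::real^'b. outer v (($) v))"
    by (intro bounded_bilinear.continuous_on[OF bounded_bilinear_outer] continuous_intros)
  then have "(\<lambda>v::real^'b. outer v (($) v)) \<in> borel_measurable borel"
    by (rule borel_measurable_continuous_onI)
  then have "(\<lambda>\<omega>. outer (w m \<omega>) (($) (w m \<omega>))) \<in> borel_measurable \<Omega>" if "m < M" for m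
    using measurable_compose[OF assms[OF that]] by blast
  then show ?thesis
    unfolding head_stats_def using assms
    by (intro borel_measurable_Pair borel_measurable_scaleR borel_measurable_const borel_measurable_sum) auto
qed

text \<open>The first statistic is linear in the heads, the second quadratic. With
  \<open>\<alpha> = 1\<close> and \<open>c = 1 / sqrt M\<close> the prefactors are
  \<open>1 / sqrt M\<close> and \<open>1 / M\<close>, which is why the reward noise survives in
  regime (ii), whereas in regime (i) both prefactors are \<open>1 / M\<close>.\<close>

lemma head_stats_scaleR:
  "head_stats \<alpha> M (\<lambda>m. c *\<^sub>R z m) =
     ((\<alpha> * c) *\<^sub>R (\<Sum>m<M. z m), (\<alpha> * c\<^sup>2) *\<^sub>R (\<Sum>m<M. outer (z m) (($) (z m))))"
  by (simp add: head_stats_def outer_def vec_eq_iff sum_distrib_left power2_eq_square mult.assoc mult.left_commute)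

lemma conv_in_prob_gram:
  fixes z :: "nat \<Rightarrow> nat \<Rightarrow> 'w \<Rightarrow> real^'k"
  assumes "prob_space \<Omega>" and z: "\<And>M. M > 0 \<Longrightarrow> gaussian_heads \<Omega> M (z M)"
    and X: "\<And>M. X M \<in> borel_measurable \<Omega>"
    and eq: "\<And>M \<omega>. M > 0 \<Longrightarrow> X M \<omega> = (1 / M) *\<^sub>R (\<Sum>m<M. outer (z M m \<omega>) (($) (z M m \<omega>)))"
  shows "conv_in_prob \<Omega> X (mat 1)"
proof (rule conv_in_prob_euclidean[OF \<open>prob_space \<Omega>\<close> X])
  interpret prob_space \<Omega> by fact
  fix i :: "real^'k^'k" assume "i \<in> Basis"
  then obtain k l where i: "i = axis k (axis l 1)"
    by (auto simp: Basis_vec_def)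
  have X_kl: "X M \<omega> \<bullet> i - mat 1 \<bullet> i = (\<Sum>m<M. z M m \<omega> $ k * z M m \<omega> $ l) / M - (if k = l then 1 else 0)"
    if "M > 0" for M \<omega>
    using eq[OF that] by (simp add: i inner_axis mat_def outer_def)
  show "conv_in_prob \<Omega> (\<lambda>M \<omega>. X M \<omega> \<bullet> i) (mat 1 \<bullet> i)"
  proof (rule conv_in_prob_L2[where V=8, OF \<open>prob_space \<Omega>\<close>])
    show "(\<lambda>\<omega>. X M \<omega> \<bullet> i) \<in> borel_measurable \<Omega>" for M using X by auto
  qed (simp_all only: X_kl gaussian_heads_gram[OF z])
qed

lemma conv_in_prob_head_mean:
  fixes z :: "nat \<Rightarrow> nat \<Rightarrow> 'w \<Rightarrow> real^'k"
  assumes "prob_space \<Omega>" and z: "\<And>M. M > 0 \<Longrightarrow> gaussian_heads \<Omega> M (z M)"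
    and X: "\<And>M. X M \<in> borel_measurable \<Omega>"
    and eq: "\<And>M \<omega>. M > 0 \<Longrightarrow> X M \<omega> = (1 / M) *\<^sub>R (\<Sum>m<M. z M m \<omega>)"
  shows "conv_in_prob \<Omega> X 0"
proof (rule conv_in_prob_euclidean[OF \<open>prob_space \<Omega>\<close> X])
  interpret prob_space \<Omega> by fact
  fix i :: "real^'k" assume "i \<in> Basis"
  then obtain k where i: "i = axis k 1"
    by (auto simp: Basis_vec_def)
  have X_k: "X M \<omega> \<bullet> i = (\<Sum>m<M. z M m \<omega> $ k) / M" if "M > 0" for M \<omega>
    using eq[OF that] by (simp add: i inner_axis)
  show "conv_in_prob \<Omega> (\<lambda>M \<omega>. X M \<omega> \<bullet> i) (0 \<bullet> i)"
  proof (rule conv_in_prob_L2[where V=1, OF \<open>prob_space \<Omega>\<close>])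
    show "(\<lambda>\<omega>. X M \<omega> \<bullet> i) \<in> borel_measurable \<Omega>" for M using X by auto
  qed (simp_all add: X_k gaussian_heads_mean[OF z])
qed

lemma prob_space_std_gauss: "prob_space std_gauss"
  unfolding std_gauss_def by (intro prob_space_PiM prob_space_normal_density) simp

lemma vec_lambda_measurable_std_gauss:
  "(\<lambda>e. \<chi> k. e k) \<in> borel_measurable (std_gauss :: ('k::finite \<Rightarrow> real) measure)"
proof (rule borel_measurable_vec_lambda)
  show "(\<lambda>e. e k) \<in> borel_measurable (std_gauss :: ('k \<Rightarrow> real) measure)" for k :: 'k
    unfolding std_gauss_def
    using measurable_component_singleton[of k UNIV "\<lambda>_. density lborel std_normal_density"]
    by (simp cong: measurable_cong_sets)
qed

text \<open>Positivity of \<open>sd M\<close> permits the division; in regime (ii) it fails exactly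
  at \<open>M = 0\<close>, where \<open>1 / sqrt 0\<close> evaluates to 0.\<close>

lemma td_model_gaussian_heads:
  assumes "prob_space \<Omega>" and td: "td_model \<Omega> P R \<gamma> \<Phi>0 \<alpha> sd w \<Phi>" and "sd M > 0"
  shows "gaussian_heads \<Omega> M (\<lambda>m \<omega>. (1 / sd M) *\<^sub>R w M m \<omega>)"
proof -
  interpret prob_space \<Omega> by fact
  have ind: "indep_vars (\<lambda>_. borel) (\<lambda>(m, k) \<omega>. w M m \<omega> $ k) ({..<M} \<times> UNIV)"
    and law: "\<And>m k. m < M \<Longrightarrow> distributed \<Omega> lborel (\<lambda>\<omega>. w M m \<omega> $ k) (normal_density 0 (sd M))"
    using td unfolding td_model_def by auto
  have "indep_vars (\<lambda>_. borel) (\<lambda>i \<omega>. (case i of (m, k) \<Rightarrow> \<lambda>\<omega>. w M m \<omega> $ k) \<omega> / sd M) ({..<M} \<times> UNIV)"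
    by (rule indep_vars_compose2[OF ind]) measurable
  also have "(\<lambda>i \<omega>. (case i of (m, k) \<Rightarrow> \<lambda>\<omega>. w M m \<omega> $ k) \<omega> / sd M)
      = (\<lambda>(m, k) \<omega>. ((1 / sd M) *\<^sub>R w M m \<omega>) $ k)"
    by (auto simp: fun_eq_iff)
  finally show ?thesis
    using law unfolding gaussian_heads_def normal_standard_normal_convert[OF \<open>sd M > 0\<close>] by simp
qed

lemma td_model_weight_measurable:
  assumes td: "td_model \<Omega> P R \<gamma> \<Phi>0 \<alpha> sd w \<Phi>" and "m < M"
  shows "w M m \<in> borel_measurable \<Omega>"
proof -
  have "distributed \<Omega> lborel (\<lambda>\<omega>. w M m \<omega> $ k) (normal_density 0 (sd M))" for k
    using td \<open>m < M\<close> unfolding td_model_def by auto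
  then have "(\<lambda>\<omega>. \<chi> k. w M m \<omega> $ k) \<in> borel_measurable \<Omega>"
    by (intro borel_measurable_vec_lambda) (use distributed_measurable in fastforce)
  then show ?thesis by simp
qed

theorem theorem5p7:
  fixes \<Omega> :: "'w measure"
    and P :: "real^'x::finite^'x" and R :: "real^'x" and \<gamma> :: real
    and \<Phi>0 :: "real^'k::finite^'x"
    and w :: "nat \<Rightarrow> nat \<Rightarrow> 'w \<Rightarrow> real^'k"
    and \<Phi> :: "nat \<Rightarrow> real \<Rightarrow> 'w \<Rightarrow> real^'k^'x"
  assumes "prob_space \<Omega>"
    and "row_stochastic P"
    and "0 \<le> \<gamma>" and "\<gamma> < 1"
  shows
   "(td_model \<Omega> P R \<gamma> \<Phi>0 (\<lambda>M. 1 / real M) (\<lambda>M. 1) w \<Phi> \<longrightarrow>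
      (\<forall>t\<ge>0.
        conv_in_prob \<Omega>
          (\<lambda>M \<omega>. td_field P R \<gamma> (1 / real M) M (\<lambda>m. w M m \<omega>) (\<Phi> M t \<omega>)
                   + (mat 1 - \<gamma> *\<^sub>R P) ** \<Phi> M t \<omega>) 0
      \<and> conv_in_prob \<Omega> (\<lambda>M \<omega>. \<Phi> M t \<omega>)
          (mat_exp ((- t) *\<^sub>R (mat 1 - \<gamma> *\<^sub>R P)) ** \<Phi>0)))
    \<and>
    (td_model \<Omega> P R \<gamma> \<Phi>0 (\<lambda>M. 1) (\<lambda>M. 1 / sqrt (real M)) w \<Phi> \<longrightarrow>
      (\<forall>t\<ge>0.
        conv_in_dist \<Omega>
          (\<lambda>M \<omega>. td_field P R \<gamma> 1 M (\<lambda>m. w M m \<omega>) (\<Phi> M t \<omega>)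
                   + (mat 1 - \<gamma> *\<^sub>R P) ** \<Phi> M t \<omega>)
          (std_gauss :: ('k \<Rightarrow> real) measure) (\<lambda>\<epsilon>. outer R \<epsilon>)
      \<and> conv_in_dist \<Omega> (\<lambda>M \<omega>. \<Phi> M t \<omega>)
          (std_gauss :: ('k \<Rightarrow> real) measure)
          (\<lambda>\<epsilon>. mat_exp ((- t) *\<^sub>R (mat 1 - \<gamma> *\<^sub>R P))
                  ** (\<Phi>0 - outer (matrix_inv (mat 1 - \<gamma> *\<^sub>R P) *v R) \<epsilon>)
                + outer (matrix_inv (mat 1 - \<gamma> *\<^sub>R P) *v R) \<epsilon>)))"
proof (intro conjI impI)
  let ?A = "mat 1 - \<gamma> *\<^sub>R P"
  \<comment> \<open>\<open>H t\<close> is the residual of the limiting dynamics as a function of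
    \<open>(b, G)\<close>.\<close>
  define H where "H t p = stats_field ?A R p (stats_flow ?A R \<Phi>0 t p) + ?A ** stats_flow ?A R \<Phi>0 t p"
    for t and p :: "(real^'k) \<times> (real^'k^'k)"
  have H_cont: "continuous_on UNIV (H t)" for t
    unfolding H_def
    by (intro continuous_intros continuous_stats_field continuous_stats_flow
         bounded_bilinear.continuous_on[OF bounded_bilinear_matrix_mult])
  \<comment> \<open>At \<open>G = I\<close> the damping term of the field cancels against the added
    \<open>A\<close> times the flow, so no formula for the flow is used.\<close>
  have H_1: "H t (b, mat 1) = outer R (($) b)" for t b
    by (simp add: H_def stats_field_def)
  have fst_meas: "fst \<in> borel_measurable (borel :: ((real^'k) \<times> (real^'k^'k)) measure)"
    and snd_meas: "snd \<in> borel_measurable (borel :: ((real^'k) \<times> (real^'k^'k)) measure)"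
    by (intro borel_measurable_continuous_onI continuous_intros)+
  have inv: "invertible ?A" using assms by (intro row_stochastic_invertible)
  have sol: "\<Phi> M t \<omega> = stats_flow ?A R \<Phi>0 t (head_stats (\<alpha> M) M (\<lambda>m. w M m \<omega>))"
    if "td_model \<Omega> P R \<gamma> \<Phi>0 \<alpha> sd w \<Phi>" "t \<ge> 0" "\<omega> \<in> space \<Omega>" for \<alpha> sd M t \<omega>
    using that td_solution_eq_stats_flow[of "\<lambda>s. \<Phi> M s \<omega>" P R \<gamma> "\<alpha> M" M "\<lambda>m. w M m \<omega>" t]
    unfolding td_model_def by auto
  have sol_field: "td_field P R \<gamma> (\<alpha> M) M (\<lambda>m. w M m \<omega>) (\<Phi> M t \<omega>) + ?A ** \<Phi> M t \<omega>
      = H t (head_stats (\<alpha> M) M (\<lambda>m. w M m \<omega>))"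
    if "td_model \<Omega> P R \<gamma> \<Phi>0 \<alpha> sd w \<Phi>" "t \<ge> 0" "\<omega> \<in> space \<Omega>" for \<alpha> sd M t \<omega>
    by (simp add: sol[OF that] td_field_eq_stats_field H_def)
  {
    assume td: "td_model \<Omega> P R \<gamma> \<Phi>0 (\<lambda>M. 1 / real M) (\<lambda>M. 1) w \<Phi>"
    define S where "S M \<omega> = head_stats (1 / real M) M (\<lambda>m. w M m \<omega>)" for M \<omega>
    have S_meas: "S M \<in> borel_measurable \<Omega>" for M
      unfolding S_def[abs_def] using td_model_weight_measurable[OF td] by (rule head_stats_measurable)
    note S_fst = measurable_compose[OF S_meas fst_meas] and S_snd = measurable_compose[OF S_meas snd_meas]
    have heads: "gaussian_heads \<Omega> M (w M)" for M
      using td_model_gaussian_heads[OF \<open>prob_space \<Omega>\<close> td, of M] by simp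
    have "conv_in_prob \<Omega> (\<lambda>M \<omega>. fst (S M \<omega>)) 0"
      by (intro conv_in_prob_head_mean[OF \<open>prob_space \<Omega>\<close> heads] S_fst) (simp add: S_def head_stats_def)
    moreover have "conv_in_prob \<Omega> (\<lambda>M \<omega>. snd (S M \<omega>)) (mat 1)"
      by (intro conv_in_prob_gram[OF \<open>prob_space \<Omega>\<close> heads] S_snd) (simp add: S_def head_stats_def)
    ultimately have "conv_in_prob \<Omega> (\<lambda>M \<omega>. (fst (S M \<omega>), snd (S M \<omega>))) (0, mat 1)"
      by (rule conv_in_prob_Pair[OF \<open>prob_space \<Omega>\<close> S_fst S_snd])
    then have S_lim: "conv_in_prob \<Omega> S (0, mat 1)" by simp
    show "\<forall>t\<ge>0.
        conv_in_prob \<Omega>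
          (\<lambda>M \<omega>. td_field P R \<gamma> (1 / real M) M (\<lambda>m. w M m \<omega>) (\<Phi> M t \<omega>) + ?A ** \<Phi> M t \<omega>) 0
      \<and> conv_in_prob \<Omega> (\<lambda>M \<omega>. \<Phi> M t \<omega>) (mat_exp ((- t) *\<^sub>R ?A) ** \<Phi>0)"
    proof (intro allI impI conjI)
      fix t :: real assume t: "t \<ge> 0"
      have zero: "outer u (($) (0::real^'k)) = 0" for u :: "real^'x"
        by (simp add: outer_def vec_eq_iff)
      have "conv_in_prob \<Omega> (\<lambda>M \<omega>. H t (S M \<omega>)) (H t (0, mat 1))"
        by (intro conv_in_prob_continuous_map[OF \<open>prob_space \<Omega>\<close> S_meas S_lim]
             continuous_on_interior[OF H_cont]) simp
      then show "conv_in_prob \<Omega>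
          (\<lambda>M \<omega>. td_field P R \<gamma> (1 / real M) M (\<lambda>m. w M m \<omega>) (\<Phi> M t \<omega>) + ?A ** \<Phi> M t \<omega>) 0"
        by (simp add: S_def sol_field[OF td t] H_1 zero cong: conv_in_prob_cong)
      \<comment> \<open>At \<open>b = 0\<close> the equilibrium is 0, so the closed form reduces to
        the exponential applied to \<open>\<Phi>0\<close>.\<close>
      have "conv_in_prob \<Omega> (\<lambda>M \<omega>. stats_flow ?A R \<Phi>0 t (S M \<omega>)) (stats_flow ?A R \<Phi>0 t (0, mat 1))"
        by (intro conv_in_prob_continuous_map[OF \<open>prob_space \<Omega>\<close> S_meas S_lim]
             continuous_on_interior[OF continuous_stats_flow]) simp
      then show "conv_in_prob \<Omega> (\<lambda>M \<omega>. \<Phi> M t \<omega>) (mat_exp ((- t) *\<^sub>R ?A) ** \<Phi>0)"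
        by (simp add: S_def sol[OF td t] stats_flow_mat_1[OF inv] zero cong: conv_in_prob_cong)
    qed
  }
  {
    assume td: "td_model \<Omega> P R \<gamma> \<Phi>0 (\<lambda>M. 1) (\<lambda>M. 1 / sqrt (real M)) w \<Phi>"
    define S where "S M \<omega> = head_stats 1 M (\<lambda>m. w M m \<omega>)" for M \<omega>
    \<comment> \<open>The nested quotient matches the normalisation in
      \<open>td_model_gaussian_heads\<close>; for positive \<open>M\<close> it is multiplication by
      \<open>sqrt M\<close>.\<close>
    define z where "z M m \<omega> = (1 / (1 / sqrt (real M))) *\<^sub>R w M m \<omega>" for M m \<omega>
    have S_meas: "S M \<in> borel_measurable \<Omega>" for M
      unfolding S_def[abs_def] using td_model_weight_measurable[OF td] by (rule head_stats_measurable)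
    note S_fst = measurable_compose[OF S_meas fst_meas] and S_snd = measurable_compose[OF S_meas snd_meas]
    have heads: "gaussian_heads \<Omega> M (z M)" if "M > 0" for M
      using td_model_gaussian_heads[OF \<open>prob_space \<Omega>\<close> td, of M] that unfolding z_def[abs_def] by simp
    have S_eq: "S M \<omega> = ((1 / sqrt M) *\<^sub>R (\<Sum>m<M. z M m \<omega>), (1 / M) *\<^sub>R (\<Sum>m<M. outer (z M m \<omega>) (($) (z M m \<omega>))))"
      if "M > 0" for M \<omega>
    proof -
      have "S M \<omega> = head_stats 1 M (\<lambda>m. (1 / sqrt M) *\<^sub>R z M m \<omega>)"
        using that by (simp add: S_def z_def)
      then show ?thesis by (simp add: head_stats_scaleR power_divide)
    qed
    have law: "distr \<Omega> borel (\<lambda>\<omega>. fst (S M \<omega>)) = distr std_gauss borel (\<lambda>e. \<chi> k. e k)" if "M > 0" for M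
      using prob_space.gaussian_heads_sum_law[OF \<open>prob_space \<Omega>\<close> heads[OF that] that] by (simp add: S_eq[OF that])
    have gram: "conv_in_prob \<Omega> (\<lambda>M \<omega>. snd (S M \<omega>)) (mat 1)"
      by (intro conv_in_prob_gram[OF \<open>prob_space \<Omega>\<close> heads] S_snd) (simp_all add: S_eq)
    \<comment> \<open>Stated for an arbitrary continuous \<open>F\<close>, this serves both the
      residual \<open>H t\<close> and the trajectory.\<close>
    have slutsky: "conv_in_dist \<Omega> (\<lambda>M \<omega>. F (S M \<omega>)) std_gauss (\<lambda>e. F (\<chi> k. e k, mat 1))"
      if "continuous_on UNIV F" for F :: "_ \<Rightarrow> real^'k^'x"
    proof -
      have "conv_in_dist \<Omega> (\<lambda>M \<omega>. F (fst (S M \<omega>), snd (S M \<omega>))) std_gauss (\<lambda>e. F (\<chi> k. e k, mat 1))"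
        by (rule conv_in_dist_slutsky[OF \<open>prob_space \<Omega>\<close> prob_space_std_gauss S_fst S_snd
              vec_lambda_measurable_std_gauss law gram that])
      then show ?thesis by simp
    qed
    have nth: "($) (\<chi> k. e k) = e" for e :: "'k \<Rightarrow> real" by (simp add: fun_eq_iff)
    show "\<forall>t\<ge>0.
        conv_in_dist \<Omega>
          (\<lambda>M \<omega>. td_field P R \<gamma> 1 M (\<lambda>m. w M m \<omega>) (\<Phi> M t \<omega>) + ?A ** \<Phi> M t \<omega>)
          (std_gauss :: ('k \<Rightarrow> real) measure) (\<lambda>\<epsilon>. outer R \<epsilon>)
      \<and> conv_in_dist \<Omega> (\<lambda>M \<omega>. \<Phi> M t \<omega>)
          (std_gauss :: ('k \<Rightarrow> real) measure)
          (\<lambda>\<epsilon>. mat_exp ((- t) *\<^sub>R ?A) ** (\<Phi>0 - outer (matrix_inv ?A *v R) \<epsilon>)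
                + outer (matrix_inv ?A *v R) \<epsilon>)"
    proof (intro allI impI conjI)
      fix t :: real assume t: "t \<ge> 0"
      have "conv_in_dist \<Omega> (\<lambda>M \<omega>. H t (S M \<omega>)) std_gauss (\<lambda>e. H t (\<chi> k. e k, mat 1))"
        by (rule slutsky[OF H_cont])
      then show "conv_in_dist \<Omega>
          (\<lambda>M \<omega>. td_field P R \<gamma> 1 M (\<lambda>m. w M m \<omega>) (\<Phi> M t \<omega>) + ?A ** \<Phi> M t \<omega>)
          (std_gauss :: ('k \<Rightarrow> real) measure) (\<lambda>\<epsilon>. outer R \<epsilon>)"
        by (simp add: S_def sol_field[OF td t] H_1 nth cong: conv_in_dist_cong)
      have "conv_in_dist \<Omega> (\<lambda>M \<omega>. stats_flow ?A R \<Phi>0 t (S M \<omega>)) std_gauss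
          (\<lambda>e. stats_flow ?A R \<Phi>0 t (\<chi> k. e k, mat 1))"
        by (rule slutsky[OF continuous_stats_flow])
      then show "conv_in_dist \<Omega> (\<lambda>M \<omega>. \<Phi> M t \<omega>)
          (std_gauss :: ('k \<Rightarrow> real) measure)
          (\<lambda>\<epsilon>. mat_exp ((- t) *\<^sub>R ?A) ** (\<Phi>0 - outer (matrix_inv ?A *v R) \<epsilon>)
                + outer (matrix_inv ?A *v R) \<epsilon>)"
        by (simp add: S_def sol[OF td t] stats_flow_mat_1[OF inv] nth cong: conv_in_dist_cong)
    qed
  }
qed

end
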